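(* Let $E,F\subset\mathbb{R}^d$ be two totally disconnected nontrivial self-similar sets, generated by IFSs of similitudes $\Phi=\{\phi_i\}_{i=1}^\ell$ and $\Psi=\{\psi_j\}_{j=1}^m$ respectively. Let $\rho_i$ and $\gamma_j$ denote the contraction ratios of $\phi_i$ and $\psi_j$. Suppose that $F$ can be affinely embedded into $E$. Suppose in addition that $\Phi$ satisfies the strong separation condition and that $\dim_H E<c$, where $$c=\begin{cases}1/4, & \text{if } \ell=2,\\ 1/4, & \text{if } \ell\ge 3,\ \lambda=1,\\ 1/(2\lambda+2), & \text{if } \ell\ge 3,\ \lambda>1,\end{cases}$$ with $\lambda=\dim \mathrm{span}_{\mathbb{Q}}(\log\rho_1,\ldots,\log\rho_\ell)$. Then for each $1\le j\le m$ there exist non-negative rational numbers $t_{i,j}$ ($1\le i\le \ell$) such that $$\gamma_j=\prod_{i=1}^{\ell}\rho_i^{t_{i,j}}.$$ In particular, if $\rho_i=\rho$ for all $1\le i\le\ell$, then $\log\gamma_j/\log\rho\in\mathbb{Q}$ for $1\le j\le m$.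
   Context: A similitude is a map $\phi:\mathbb{R}^d\to\mathbb{R}^d$ of the form $\phi(x)=\rho P x+a$ with $\rho>0$, $a\in\mathbb{R}^d$ and $P$ a $d\times d$ orthogonal matrix; when $\phi$ is contractive (i.e. $\rho<1$), $\rho$ is its contraction ratio. An iterated function system (IFS) on $\mathbb{R}^d$ is a finite family $\Phi=\{\phi_i\}_{i=1}^\ell$ of contractive mappings of $\mathbb{R}^d$; its attractor is the unique non-empty compact set $K$ with $K=\bigcup_{i=1}^\ell\phi_i(K)$, and $\Phi$ is called a generating IFS of $K$ (one says $K$ is generated by $\Phi$). A self-similar set is the attractor of an IFS all of whose maps are similitudes; it is nontrivial if it is not a singleton. $\Phi$ with attractor $K$ satisfies the strong separation condition if the sets $\phi_i(K)$, $1\le i\le \ell$, are pairwise disjoint. For $A,B\subset\mathbb{R}^d$, $A$ can be affinely embedded into $B$ if $f(A)\subset B$ for some map $f(x)=Mx+a$ with $M$ an invertible real $d\times d$ matrix and $a\in\mathbb{R}^d$. $\dim_H$ denotes Hausdorff dimension. For $u_1,\dots,u_k\in\mathbb{R}$, $\mathrm{span}_{\mathbb{Q}}(u_1,\ldots,u_k)=\{\sum_{i=1}^k t_iu_i: t_i\in\mathbb{Q}\}$, and its dimension is taken as a vector space over $\mathbb{Q}$. *)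

theory Defs
  imports "HOL-Analysis.Analysis"
begin

text \<open>Since \<open>CARD('n) \<ge> 1\<close>, the ratio is determined by the map.\<close>

definition similitude :: "real \<Rightarrow> (real^'n \<Rightarrow> real^'n) \<Rightarrow> bool" where
  "similitude \<rho> \<phi> \<longleftrightarrow>
     \<rho> > 0 \<and> (\<exists>P a. orthogonal_matrix P \<and> (\<forall>x. \<phi> x = \<rho> *\<^sub>R (P *v x) + a))"

definition similitude_ifs :: "nat \<Rightarrow> (nat \<Rightarrow> real^'n \<Rightarrow> real^'n) \<Rightarrow> (nat \<Rightarrow> real) \<Rightarrow> bool" where
  "similitude_ifs l \<phi> \<rho> \<longleftrightarrow> (\<forall>i\<in>{1..l}. similitude (\<rho> i) (\<phi> i) \<and> \<rho> i < 1)"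

text \<open>For contractive maps, a set satisfying the following predicate is unique.\<close>

definition attractor :: "nat \<Rightarrow> (nat \<Rightarrow> 'a \<Rightarrow> 'a) \<Rightarrow> 'a::topological_space set \<Rightarrow> bool" where
  "attractor l \<phi> K \<longleftrightarrow> K \<noteq> {} \<and> compact K \<and> K = (\<Union>i\<in>{1..l}. \<phi> i ` K)"

definition strong_separation :: "nat \<Rightarrow> (nat \<Rightarrow> 'a \<Rightarrow> 'a) \<Rightarrow> 'a set \<Rightarrow> bool" where
  "strong_separation l \<phi> K \<longleftrightarrow> disjoint_family_on (\<lambda>i. \<phi> i ` K) {1..l}"

definition totally_disconnected :: "'a::topological_space set \<Rightarrow> bool" where
  "totally_disconnected S \<longleftrightarrow> (\<forall>x\<in>S. connected_component_set S x = {x})"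

definition nontrivial :: "'a set \<Rightarrow> bool" where
  "nontrivial K \<longleftrightarrow> \<not> is_singleton K"

definition affinely_embeddable :: "(real^'n) set \<Rightarrow> (real^'n) set \<Rightarrow> bool" where
  "affinely_embeddable A B \<longleftrightarrow>
     (\<exists>(M :: real^'n^'n) a. invertible M \<and> (\<lambda>x. M *v x + a) ` A \<subseteq> B)"

text \<open>
  The case distinction in \<open>diam_pow\<close> implements the convention
  that the \<open>0\<close>-th power of the diameter is \<open>1\<close> for every nonempty set and \<open>0\<close> for the empty set,
  whereas \<open>0 powr 0 = 0\<close>. Covering sets are required to be bounded because
  \<^const>\<open>diameter\<close> is only meaningful for bounded sets.
\<close>

definition diam_pow :: "real \<Rightarrow> 'a::metric_space set \<Rightarrow> ennreal" where
  "diam_pow s U = (if U = {} then 0 else if s = 0 then 1 else ennreal (diameter U powr s))"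

definition hausdorff_premeasure :: "real \<Rightarrow> real \<Rightarrow> 'a::metric_space set \<Rightarrow> ennreal" where
  "hausdorff_premeasure s \<delta> A =
     (INF U\<in>{U :: nat \<Rightarrow> 'a set. A \<subseteq> (\<Union>k. U k) \<and> (\<forall>k. bounded (U k) \<and> diameter (U k) \<le> \<delta>)}.
        \<Sum>k. diam_pow s (U k))"

definition hausdorff_measure :: "real \<Rightarrow> 'a::metric_space set \<Rightarrow> ennreal" where
  "hausdorff_measure s A = (SUP \<delta>\<in>{0<..}. hausdorff_premeasure s \<delta> A)"

definition hausdorff_dim :: "'a::metric_space set \<Rightarrow> ennreal" where
  "hausdorff_dim A = (INF s\<in>{s. s \<ge> 0 \<and> hausdorff_measure s A = 0}. ennreal s)"

definition rat_scale :: "rat \<Rightarrow> real \<Rightarrow> real" where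
  "rat_scale q x = of_rat q * x"

global_interpretation rat_vs: vector_space rat_scale
  by unfold_locales (auto simp: rat_scale_def algebra_simps of_rat_add of_rat_mult)

definition log_ratio_rank :: "nat \<Rightarrow> (nat \<Rightarrow> real) \<Rightarrow> nat" where
  "log_ratio_rank l \<rho> = rat_vs.dim (rat_vs.span ((\<lambda>i. ln (\<rho> i)) ` {1..l}))"

text \<open>
  For ratios of an IFS of contractive similitudes with a nontrivial attractor one has \<open>l \<ge> 2\<close>
  and \<open>lam \<ge> 1\<close>, so that the last branch is the case \<open>l \<ge> 3\<close>, \<open>lam > 1\<close>.
\<close>

definition dim_bound :: "nat \<Rightarrow> nat \<Rightarrow> real" where
  "dim_bound l lam =
     (if l = 2 then 1 / 4 else if lam = 1 then 1 / 4 else 1 / (2 * real lam + 2))"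

end

theory Submission
  imports Defs "HOL-Library.Function_Algebras" "HOL-Real_Asymp.Real_Asymp"
begin

text \<open>
Let \<open>f\<close> be the affine map from \<open>F\<close> into \<open>E\<close>, with linear part \<open>M\<close>, and fix \<open>j\<close>. Write
\<open>\<psi>\<^sub>j x = \<gamma> P x + b\<close>, let \<open>x\<^sub>0\<close> be its fixed point, which lies in \<open>F\<close>, and choose another point
\<open>x\<^sub>0 + v\<close> of \<open>F\<close>. The images under \<open>f\<close> of the iterates of \<open>x\<^sub>0 + v\<close> form a sequence of points of \<open>E\<close>
that converges to \<open>u = f x\<^sub>0\<close>, and the \<open>n\<close>-th one has distance \<open>\<gamma>\<^sup>n |M P\<^sup>n v|\<close> from \<open>u\<close>. Since \<open>E\<close> is
strongly separated, a cylinder map of ratio \<open>r\<close> comparable to this distance carries two points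
\<open>z, w \<in> E\<close>, at a distance bounded below, to the \<open>n\<close>-th point and \<open>u\<close>. Hence
\<open>n ln \<gamma> + ln |M P\<^sup>n v| - ln r = ln |z - w|\<close>, and up to an error \<open>\<delta>\<close> the right-hand side takes at most
\<open>O(\<delta>\<^sup>-\<^sup>2\<^sup>s)\<close> values when \<open>s > dim\<^sub>H E\<close>, because \<open>E\<close> is covered by \<open>O(\<delta>\<^sup>-\<^sup>s)\<close> sets of diameter \<open>\<delta>\<close>
(\<open>null_set_colouring_exponent\<close>). The theorem follows by showing that otherwise the left-hand side
takes too many values.

First the rotation \<open>P\<close> is removed. The numbers \<open>|M P\<^sup>n v|\<^sup>2\<close> are values of a linear functional along the
orbit of an isometry of a space of matrices. After replacing \<open>\<psi>\<^sub>j\<close> by a power they are either constant,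
or the differences \<open>ln |M P\<^sup>n\<^sup>+\<^sup>N v| - ln |M P\<^sup>n v|\<close>, for some fixed \<open>N\<close>, are dense in an interval
(\<open>log_ratio_dense_in_interval\<close>). The second case needs \<open>1/\<delta>\<close> values up to an error \<open>\<delta>\<close>, but each such
difference is determined by three points of \<open>E\<close>, so \<open>3 s \<ge> 1\<close>, which the bound \<open>1/4\<close> on the
dimension excludes.

In the first case let \<open>g = - ln \<gamma>\<close> and \<open>a\<^sub>i = - ln \<rho>\<^sub>i\<close>, and let \<open>\<iota>\<close> be a coding of \<open>u\<close>. The partial
sums \<open>y\<^sub>k\<close> of the sequence of steps \<open>a\<^sub>i\<close> read along \<open>\<iota>\<close>, taken modulo \<open>g\<close>, are an orbit on a circle on which every step is one of
finitely many rotations, and up to an error \<open>\<delta>\<close> they take \<open>O(\<delta>\<^sup>-\<^sup>2\<^sup>s)\<close> values. If \<open>g\<close> is not a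
non-negative rational combination of the \<open>a\<^sub>i\<close>, then this is impossible for small \<open>s\<close>:

\<^item> In general (\<open>slow_walk_exponent\<close>), simultaneous Dirichlet approximation gives \<open>q \<le> Q\<^sup>r\<close> such that
  multiplication by \<open>q\<close> turns the orbit into a walk on the circle with steps \<open>O(1/Q)\<close>, where \<open>r\<close> is at
  most the rank of the \<open>a\<^sub>i\<close> over the rationals. For infinitely many \<open>Q\<close> this walk is not trapped in a short arc; it
  then visits of the order of \<open>Q\<close> separate arcs of length \<open>1/Q\<close>, so the original orbit has that many
  values at scale \<open>Q\<^sup>-\<^sup>r\<^sup>-\<^sup>1\<close>, whence \<open>2 s \<ge> 1/(r + 1)\<close>.

\<^item> For two maps the bound is \<open>2 s \<ge> 1/2\<close>. If \<open>r = 2\<close>, either the differences \<open>y\<^sub>k\<^sub>+\<^sub>p - y\<^sub>k\<close> run through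
  arbitrarily long stretches of an orbit of the single rotation by \<open>a\<^sub>2 - a\<^sub>1\<close>
  (\<open>two_letter_exponent_unbounded_discrepancy\<close>), or the letters of \<open>\<iota>\<close> have a frequency with bounded
  discrepancy, and a one-dimensional Dirichlet approximation compares the orbit with an irrational rotation
  (\<open>two_letter_exponent_bounded_discrepancy\<close>).
\<close>

section \<open>Colourings and box dimension\<close>

lemma discrete_intermediate_value:
  fixes h :: "nat \<Rightarrow> real"
  assumes "h 0 \<le> x" "x \<le> h K" and step: "\<And>k. h (Suc k) \<le> h k + \<eta>" and "0 \<le> \<eta>"
  obtains k where "x \<le> h k" "h k \<le> x + \<eta>"
proof -
  define k where "k = (LEAST k. x \<le> h k)"
  have k: "x \<le> h k"
    unfolding k_def using assms(2) by (rule LeastI)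
  have "h k \<le> x + \<eta>"
  proof (cases k)
    case 0
    then show ?thesis using assms by simp
  next
    case (Suc k')
    then have "h k' < x"
      using not_less_Least[of k' "\<lambda>k. x \<le> h k"] k_def by auto
    then show ?thesis using step[of k'] unfolding Suc by linarith
  qed
  with k that show thesis by blast
qed

text \<open>
For \<open>close \<delta> x y \<longleftrightarrow> dist x y \<le> \<delta>\<close> this says that \<open>X\<close> splits into \<open>O(\<delta>\<^sup>-\<^sup>\<sigma>)\<close> pieces of diameter at
most \<open>\<delta>\<close>, so \<open>\<sigma>\<close> bounds the upper box dimension of \<open>X\<close>. The closeness relation is arbitrary because it
will also be distance on a circle and simultaneous closeness of several points, and colours replace
covering sets because they pull back along maps and combine into pairs.
\<close>

definition colouring_exponent :: "'k set \<Rightarrow> (real \<Rightarrow> 'k \<Rightarrow> 'k \<Rightarrow> bool) \<Rightarrow> real \<Rightarrow> bool" where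
  "colouring_exponent X close \<sigma> \<longleftrightarrow>
     (\<exists>C>0. \<forall>\<delta>. 0 < \<delta> \<and> \<delta> \<le> 1 \<longrightarrow>
        (\<exists>(col :: 'k \<Rightarrow> nat) N. (\<forall>x\<in>X. col x < N) \<and> real N \<le> C * \<delta> powr (- \<sigma>) \<and>
           (\<forall>x\<in>X. \<forall>y\<in>X. col x = col y \<longrightarrow> close \<delta> x y)))"

lemma colouring_exponentE:
  assumes "colouring_exponent X close \<sigma>"
  obtains C where "C > 0" and
    "\<And>\<delta>. 0 < \<delta> \<Longrightarrow> \<delta> \<le> 1 \<Longrightarrow> \<exists>(col :: 'k \<Rightarrow> nat) N. (\<forall>x\<in>X. col x < N) \<and>
        real N \<le> C * \<delta> powr (- \<sigma>) \<and> (\<forall>x\<in>X. \<forall>y\<in>X. col x = col y \<longrightarrow> close \<delta> x y)"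
  using assms unfolding colouring_exponent_def by blast

lemma colouring_exponent_pullback:
  assumes "colouring_exponent X close \<sigma>" and z: "\<And>k. k \<in> Y \<Longrightarrow> z k \<in> X"
  shows "colouring_exponent Y (\<lambda>\<delta> k k'. close \<delta> (z k) (z k')) \<sigma>"
proof -
  obtain C where C: "C > 0"
    "\<And>\<delta>. 0 < \<delta> \<Longrightarrow> \<delta> \<le> 1 \<Longrightarrow> \<exists>(col :: 'a \<Rightarrow> nat) N. (\<forall>x\<in>X. col x < N) \<and>
        real N \<le> C * \<delta> powr (- \<sigma>) \<and> (\<forall>x\<in>X. \<forall>y\<in>X. col x = col y \<longrightarrow> close \<delta> x y)"
    using assms(1) by (rule colouring_exponentE) blast
  show ?thesis
    unfolding colouring_exponent_def
  proof (intro exI[of _ C] conjI allI impI)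
    fix \<delta> :: real assume "0 < \<delta> \<and> \<delta> \<le> 1"
    then obtain col :: "'a \<Rightarrow> nat" and N where "\<forall>x\<in>X. col x < N" "real N \<le> C * \<delta> powr (- \<sigma>)"
      "\<forall>x\<in>X. \<forall>y\<in>X. col x = col y \<longrightarrow> close \<delta> x y"
      using C(2) by blast
    then show "\<exists>col N. (\<forall>x\<in>Y. col x < N) \<and> real N \<le> C * \<delta> powr - \<sigma> \<and>
           (\<forall>x\<in>Y. \<forall>y\<in>Y. col x = col y \<longrightarrow> close \<delta> (z x) (z y))"
      using z by (intro exI[of _ "col \<circ> z"] exI[of _ N]) auto
  qed (rule C(1))
qed

lemma colouring_exponent_conj:
  assumes "colouring_exponent X c1 \<sigma>1" "colouring_exponent X c2 \<sigma>2"
  shows "colouring_exponent X (\<lambda>\<delta> x y. c1 \<delta> x y \<and> c2 \<delta> x y) (\<sigma>1 + \<sigma>2)"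
proof -
  obtain C where C: "C > 0"
    "\<And>\<delta>. 0 < \<delta> \<Longrightarrow> \<delta> \<le> 1 \<Longrightarrow> \<exists>(col :: 'a \<Rightarrow> nat) N. (\<forall>x\<in>X. col x < N) \<and>
        real N \<le> C * \<delta> powr (- \<sigma>1) \<and> (\<forall>x\<in>X. \<forall>y\<in>X. col x = col y \<longrightarrow> c1 \<delta> x y)"
    using assms(1) by (rule colouring_exponentE) blast
  obtain D where D: "D > 0"
    "\<And>\<delta>. 0 < \<delta> \<Longrightarrow> \<delta> \<le> 1 \<Longrightarrow> \<exists>(col :: 'a \<Rightarrow> nat) N. (\<forall>x\<in>X. col x < N) \<and>
        real N \<le> D * \<delta> powr (- \<sigma>2) \<and> (\<forall>x\<in>X. \<forall>y\<in>X. col x = col y \<longrightarrow> c2 \<delta> x y)"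
    using assms(2) by (rule colouring_exponentE) blast
  show ?thesis
    unfolding colouring_exponent_def
  proof (intro exI[of _ "C * D"] conjI allI impI)
    show "C * D > 0" using C D by simp
    fix \<delta> :: real assume \<delta>: "0 < \<delta> \<and> \<delta> \<le> 1"
    obtain col1 :: "'a \<Rightarrow> nat" and N1 where 1: "\<forall>x\<in>X. col1 x < N1" "real N1 \<le> C * \<delta> powr (- \<sigma>1)"
      "\<forall>x\<in>X. \<forall>y\<in>X. col1 x = col1 y \<longrightarrow> c1 \<delta> x y"
      using C(2) \<delta> by blast
    obtain col2 :: "'a \<Rightarrow> nat" and N2 where 2: "\<forall>x\<in>X. col2 x < N2" "real N2 \<le> D * \<delta> powr (- \<sigma>2)"
      "\<forall>x\<in>X. \<forall>y\<in>X. col2 x = col2 y \<longrightarrow> c2 \<delta> x y"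
      using D(2) \<delta> by blast
    define col where "col x = col1 x * N2 + col2 x" for x
    have "col x < N1 * N2" if "x \<in> X" for x
    proof -
      have "col x < (col1 x + 1) * N2"
        using 2(1) that by (simp add: col_def)
      also have "\<dots> \<le> N1 * N2"
        using 1(1) that by (intro mult_right_mono) auto
      finally show ?thesis .
    qed
    moreover have "real (N1 * N2) \<le> C * D * \<delta> powr (- (\<sigma>1 + \<sigma>2))"
    proof -
      have "real N1 * real N2 \<le> (C * \<delta> powr (- \<sigma>1)) * (D * \<delta> powr (- \<sigma>2))"
        using 1(2) 2(2) C(1) by (intro mult_mono) auto
      also have "\<dots> = C * D * \<delta> powr (- (\<sigma>1 + \<sigma>2))"
        by (simp add: powr_add[symmetric] mult_ac)
      finally show ?thesis by simp
    qed
    moreover have "c1 \<delta> x y \<and> c2 \<delta> x y" if "x \<in> X" "y \<in> X" "col x = col y" for x y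
    proof -
      have lt: "col2 x < N2" "col2 y < N2" using that 2(1) by auto
      have "col x div N2 = col1 x" "col y div N2 = col1 y" "col x mod N2 = col2 x" "col y mod N2 = col2 y"
        using lt by (auto simp: col_def)
      then have "col1 x = col1 y" "col2 x = col2 y" using that(3) by simp_all
      then show ?thesis using 1(3) 2(3) that by blast
    qed
    ultimately show "\<exists>col N. (\<forall>x\<in>X. col x < N) \<and> real N \<le> C * D * \<delta> powr - (\<sigma>1 + \<sigma>2) \<and>
        (\<forall>x\<in>X. \<forall>y\<in>X. col x = col y \<longrightarrow> c1 \<delta> x y \<and> c2 \<delta> x y)"
      by blast
  qed
qed

lemma colouring_exponent_rescale:
  assumes "colouring_exponent X c \<sigma>" "A \<ge> 1"
    and imp: "\<And>\<delta> x y. 0 < \<delta> \<Longrightarrow> x \<in> X \<Longrightarrow> y \<in> X \<Longrightarrow> c (\<delta> / A) x y \<Longrightarrow> c' \<delta> x y"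
  shows "colouring_exponent X c' \<sigma>"
proof -
  obtain C where C: "C > 0"
    "\<And>\<delta>. 0 < \<delta> \<Longrightarrow> \<delta> \<le> 1 \<Longrightarrow> \<exists>(col :: 'a \<Rightarrow> nat) N. (\<forall>x\<in>X. col x < N) \<and>
        real N \<le> C * \<delta> powr (- \<sigma>) \<and> (\<forall>x\<in>X. \<forall>y\<in>X. col x = col y \<longrightarrow> c \<delta> x y)"
    using assms(1) by (rule colouring_exponentE) blast
  show ?thesis
    unfolding colouring_exponent_def
  proof (intro exI[of _ "C * A powr \<sigma>"] conjI allI impI)
    show "C * A powr \<sigma> > 0" using C assms by simp
    fix \<delta> :: real assume \<delta>: "0 < \<delta> \<and> \<delta> \<le> 1"
    have "0 < \<delta> / A" "\<delta> / A \<le> 1" using \<delta> assms(2) by (auto simp: divide_simps)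
    then obtain col :: "'a \<Rightarrow> nat" and N where 1: "\<forall>x\<in>X. col x < N" "real N \<le> C * (\<delta> / A) powr (- \<sigma>)"
      "\<forall>x\<in>X. \<forall>y\<in>X. col x = col y \<longrightarrow> c (\<delta> / A) x y"
      using C(2) by blast
    have "C * (\<delta> / A) powr (- \<sigma>) = C * A powr \<sigma> * \<delta> powr (- \<sigma>)"
      using \<delta> assms(2) by (simp add: powr_divide powr_minus field_simps)
    then show "\<exists>col N. (\<forall>x\<in>X. col x < N) \<and> real N \<le> C * A powr \<sigma> * \<delta> powr - \<sigma> \<and>
           (\<forall>x\<in>X. \<forall>y\<in>X. col x = col y \<longrightarrow> c' \<delta> x y)"
      using 1 imp \<delta> by (intro exI[of _ col] exI[of _ N]) auto
  qed
qed

text \<open>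
At scale \<open>\<delta> = \<kappa>' Q\<^sup>-\<^sup>e\<close> pairwise non-close points have different colours, so \<open>\<kappa> Q\<close> of them force
\<open>Q = O(Q\<^sup>\<sigma>\<^sup>e)\<close>. Arbitrarily large \<open>Q\<close> suffice, since the colouring exists at every scale; this is what
makes the bounds independent of how well the angles are approximable.
\<close>

lemma colouring_exponent_lower_bound:
  assumes "colouring_exponent X c \<sigma>" and pos: "e > 0" "\<kappa> > 0" "\<kappa>' > 0"
    and sep: "\<And>Q0 :: nat. \<exists>Q M f. Q \<ge> Q0 \<and> \<kappa> * real Q \<le> real M \<and> (\<forall>m<M. f m \<in> X) \<and>
       (\<forall>m<M. \<forall>m'<M. m \<noteq> m' \<longrightarrow> \<not> c (\<kappa>' * real Q powr (- e)) (f m) (f (m' :: nat)))"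
  shows "1 \<le> \<sigma> * e"
proof (rule ccontr)
  assume "\<not> 1 \<le> \<sigma> * e"
  then have s: "1 - \<sigma> * e > 0" by simp
  obtain C where C: "C > 0"
    "\<And>\<delta>. 0 < \<delta> \<Longrightarrow> \<delta> \<le> 1 \<Longrightarrow> \<exists>(col :: 'a \<Rightarrow> nat) N. (\<forall>x\<in>X. col x < N) \<and>
        real N \<le> C * \<delta> powr (- \<sigma>) \<and> (\<forall>x\<in>X. \<forall>y\<in>X. col x = col y \<longrightarrow> c \<delta> x y)"
    using assms(1) by (rule colouring_exponentE) blast
  define B where "B = C * \<kappa>' powr (- \<sigma>) / \<kappa>"
  have "filterlim (\<lambda>Q::nat. real Q powr (1 - \<sigma> * e)) at_top sequentially"
    using s by real_asymp
  then have ev1: "eventually (\<lambda>Q::nat. B < real Q powr (1 - \<sigma> * e)) sequentially"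
    by (simp add: filterlim_at_top_dense)
  have "(\<lambda>Q::nat. \<kappa>' * real Q powr (- e)) \<longlonglongrightarrow> \<kappa>' * 0"
    using pos(1) by (intro tendsto_mult tendsto_const tendsto_neg_powr filterlim_real_sequentially) auto
  then have ev2: "eventually (\<lambda>Q::nat. \<kappa>' * real Q powr (- e) < 1) sequentially"
    by (rule order_tendstoD) simp
  have "eventually (\<lambda>Q::nat. Q > 0 \<and> B < real Q powr (1 - \<sigma> * e) \<and> \<kappa>' * real Q powr (- e) < 1) sequentially"
    using ev1 ev2 eventually_gt_at_top[of 0] by eventually_elim simp
  then obtain Q0 where Q0: "\<And>Q. Q \<ge> Q0 \<Longrightarrow> Q > 0 \<and> B < real Q powr (1 - \<sigma> * e) \<and> \<kappa>' * real Q powr (- e) < 1"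
    by (auto simp: eventually_sequentially)
  obtain Q M f where Q: "Q \<ge> Q0" "\<kappa> * real Q \<le> real M" "\<forall>m<M. f m \<in> X"
    "\<forall>m<M. \<forall>m'<M. m \<noteq> m' \<longrightarrow> \<not> c (\<kappa>' * real Q powr (- e)) (f m) (f m')"
    using sep[of Q0] by blast
  note q = Q0[OF Q(1)]
  define \<delta> where "\<delta> = \<kappa>' * real Q powr (- e)"
  have "0 < \<delta>" "\<delta> \<le> 1" using q pos by (auto simp: \<delta>_def)
  then obtain col :: "'a \<Rightarrow> nat" and N where 1: "\<forall>x\<in>X. col x < N" "real N \<le> C * \<delta> powr (- \<sigma>)"
      "\<forall>x\<in>X. \<forall>y\<in>X. col x = col y \<longrightarrow> c \<delta> x y"
    using C(2) by blast
  have inj: "inj_on (col \<circ> f) {..<M}"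
    using Q(3,4) 1(3) unfolding \<delta>_def inj_on_def by (metis comp_apply lessThan_iff)
  have "card {..<M} \<le> card {..<N}"
    by (rule card_inj_on_le[OF inj]) (use 1 Q(3) in auto)
  then have "\<kappa> * real Q \<le> C * \<delta> powr (- \<sigma>)"
    using Q(2) 1(2) by simp
  also have "\<delta> powr (- \<sigma>) = \<kappa>' powr (- \<sigma>) * real Q powr (\<sigma> * e)"
    using q pos by (simp add: \<delta>_def powr_mult powr_powr mult.commute)
  finally have "real Q \<le> B * real Q powr (\<sigma> * e)"
    using pos by (simp add: B_def field_simps)
  also have "\<dots> < real Q powr (1 - \<sigma> * e) * real Q powr (\<sigma> * e)"
    using q by (intro mult_strict_right_mono) auto
  also have "\<dots> = real Q"
    using q by (simp add: powr_add[symmetric])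
  finally show False by simp
qed

section \<open>Slow walks on the circle\<close>

text \<open>
Extending a basis of the rational vector space of bounded sequences by \<open>c\<close> and then to all sequences
gives a functional that vanishes on bounded sequences. It turns the boundedness of a real combination
of integer sequences into a linear relation between rational numbers.
\<close>

lemma rational_functional_detecting_unboundedness:
  fixes c :: "nat \<Rightarrow> real"
  assumes "\<not> (\<exists>B. \<forall>k. \<bar>c k\<bar> \<le> B)"
  obtains f :: "(nat \<Rightarrow> real) \<Rightarrow> rat"
  where "\<And>s t. f (\<lambda>k. s k + t k) = f s + f t" "\<And>q s. f (\<lambda>k. of_rat q * s k) = q * f s"
    and "\<And>s. \<exists>B. \<forall>k. \<bar>s k\<bar> \<le> B \<Longrightarrow> f s = 0" "f c = 1"
proof -
  interpret S: vector_space "\<lambda>(q::rat) (s::nat \<Rightarrow> real) k. of_rat q * s k"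
    by unfold_locales (auto simp: fun_eq_iff algebra_simps of_rat_add of_rat_mult)
  interpret T: vector_space "(*) :: rat \<Rightarrow> rat \<Rightarrow> rat"
    by unfold_locales (auto simp: algebra_simps)
  interpret P: vector_space_pair "\<lambda>(q::rat) (s::nat \<Rightarrow> real) k. of_rat q * s k" "(*) :: rat \<Rightarrow> rat \<Rightarrow> rat"
    by unfold_locales
  define U where "U = {s :: nat \<Rightarrow> real. \<exists>B. \<forall>k. \<bar>s k\<bar> \<le> B}"
  have U: "S.subspace U"
  proof (rule S.subspaceI)
    show "0 \<in> U" by (auto simp: U_def)
  next
    fix s t assume "s \<in> U" "t \<in> U"
    then obtain B1 B2 where "\<forall>k. \<bar>s k\<bar> \<le> B1" "\<forall>k. \<bar>t k\<bar> \<le> B2" by (auto simp: U_def)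
    then have "\<bar>(s + t) k\<bar> \<le> B1 + B2" for k
      using abs_triangle_ineq[of "s k" "t k"] by (smt (verit) plus_fun_apply)
    then show "s + t \<in> U" by (auto simp: U_def)
  next
    fix q s assume "s \<in> U"
    then obtain B where "\<forall>k. \<bar>s k\<bar> \<le> B" by (auto simp: U_def)
    then have "\<bar>of_rat q * s k\<bar> \<le> \<bar>of_rat q\<bar> * B" for k
      by (simp add: abs_mult mult_left_mono)
    then show "(\<lambda>k. of_rat q * s k) \<in> U" unfolding U_def by blast
  qed
  obtain B where B: "B \<subseteq> U" "S.independent B" "U \<subseteq> S.span B"
    using S.maximal_independent_subset by blast
  have span: "S.span B = U"
    using B U by (metis S.span_eq_iff S.span_mono subset_antisym)
  have "c \<notin> S.span B" using assms span by (auto simp: U_def)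
  then have ind: "S.independent (insert c B)" "c \<notin> B"
    using B(2) S.independent_insertI S.span_base by blast+
  obtain f where f: "Vector_Spaces.linear (\<lambda>(q::rat) (s::nat \<Rightarrow> real) k. of_rat q * s k) (*) f"
      "\<forall>x\<in>insert c B. f x = (if x = c then 1 else 0)"
    using P.linear_independent_extend[OF ind(1), of "\<lambda>x. if x = c then 1 else 0"] by blast
  interpret L: Vector_Spaces.linear "\<lambda>(q::rat) (s::nat \<Rightarrow> real) k. of_rat q * s k" "(*) :: rat \<Rightarrow> rat \<Rightarrow> rat" f
    by (rule f(1))
  show thesis
  proof
    show "f (\<lambda>k. s k + t k) = f s + f t" for s t
      using L.add[of s t] by (simp add: plus_fun_def)
    show "f (\<lambda>k. of_rat q * s k) = q * f s" for q s
      by (rule L.scale)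
    show "f s = 0" if "\<exists>B. \<forall>k. \<bar>s k\<bar> \<le> B" for s
    proof -
      have "s \<in> S.span B" using that span by (auto simp: U_def)
      then show ?thesis
        by (rule P.linear_eq_0_on_span[OF f(1), rotated]) (use f(2) ind(2) in auto)
    qed
    show "f c = 1" using f(2) by simp
  qed
qed

text \<open>
An integer vector sequence that is unbounded in one coordinate stays unbounded in the direction of
\<open>q \<beta> - p\<close> for infinitely many of the Dirichlet approximations. Otherwise the functional above gives
rationals \<open>m\<^sub>0\<close> and \<open>m\<^sub>j\<close>, not all zero, with \<open>q m\<^sub>0 = \<Sum> p\<^sub>j m\<^sub>j\<close> for all large \<open>Q\<close>. Dividing by \<open>q\<close>
and letting \<open>Q\<close> tend to infinity yields \<open>m\<^sub>0 = \<Sum> m\<^sub>j \<beta>\<^sub>j\<close>, against independence.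
\<close>

lemma unbounded_along_approximations:
  fixes \<beta> :: "nat \<Rightarrow> real" and C :: "nat \<Rightarrow> nat \<Rightarrow> int" and q :: "nat \<Rightarrow> int" and p :: "nat \<Rightarrow> nat \<Rightarrow> int"
  assumes indep: "\<And>m0 m. of_rat m0 = (\<Sum>j<r. of_rat (m j) * \<beta> j) \<Longrightarrow> \<forall>j<r. m j = (0::rat)"
    and j0: "j0 < r" "\<not> (\<exists>B. \<forall>k. \<bar>real_of_int (C k j0)\<bar> \<le> B)"
    and q: "\<And>Q. Q \<ge> 1 \<Longrightarrow> q Q \<ge> 1"
    and approx: "\<And>Q j. Q \<ge> 1 \<Longrightarrow> j < r \<Longrightarrow> \<bar>of_int (q Q) * \<beta> j - of_int (p Q j)\<bar> \<le> 1 / real Q"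
  shows "\<exists>Q\<ge>Q0. \<not> (\<exists>B. \<forall>k. \<bar>\<Sum>j<r. of_int (C k j) * (of_int (q Q) * \<beta> j - of_int (p Q j))\<bar> \<le> B)"
proof (rule ccontr)
  assume "\<not> ?thesis"
  then have bdd: "\<exists>B. \<forall>k. \<bar>\<Sum>j<r. of_int (C k j) * (of_int (q Q) * \<beta> j - of_int (p Q j))\<bar> \<le> B" if "Q \<ge> Q0" for Q
    using that by blast
  obtain f :: "(nat \<Rightarrow> real) \<Rightarrow> rat"
    where f: "\<And>s t. f (\<lambda>k. s k + t k) = f s + f t" "\<And>q s. f (\<lambda>k. of_rat q * s k) = q * f s"
      "\<And>s. \<exists>B. \<forall>k. \<bar>s k\<bar> \<le> B \<Longrightarrow> f s = 0" "f (\<lambda>k. of_int (C k j0)) = 1"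
    using rational_functional_detecting_unboundedness[OF j0(2)] by blast
  have f0: "f (\<lambda>k. 0) = 0" using f(3)[of "\<lambda>_. 0"] by auto
  have fsum: "f (\<lambda>k. \<Sum>j<n. of_rat (c j) * s j k) = (\<Sum>j<n. c j * f (s j))" for n and c :: "nat \<Rightarrow> rat" and s
    by (induction n) (simp_all add: f0 f(1,2))
  define m where "m j = f (\<lambda>k. of_int (C k j))" for j
  define m0 where "m0 = f (\<lambda>k. \<Sum>j<r. of_int (C k j) * \<beta> j)"
  have rel: "of_int (q Q) * m0 = (\<Sum>j<r. of_int (p Q j) * m j)" if "Q \<ge> Q0" for Q
  proof -
    have eq: "(\<Sum>j<r. of_int (C k j) * (of_int (q Q) * \<beta> j - of_int (p Q j)))
        = of_rat (of_int (q Q)) * (\<Sum>j<r. of_int (C k j) * \<beta> j) + (\<Sum>j<r. of_rat (- of_int (p Q j)) * of_int (C k j))" for k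
      by (simp add: sum_distrib_left algebra_simps sum_subtractf sum_negf of_rat_minus)
    have "0 = f (\<lambda>k. \<Sum>j<r. of_int (C k j) * (of_int (q Q) * \<beta> j - of_int (p Q j)))"
      using f(3)[OF bdd[OF that]] by simp
    also have "\<dots> = of_int (q Q) * m0 + (\<Sum>j<r. - of_int (p Q j) * m j)"
      unfolding eq f(1) f(2) fsum m0_def m_def ..
    finally show ?thesis by (simp add: sum_negf)
  qed
  define S where "S = (\<Sum>j<r. \<bar>of_rat (m j) :: real\<bar>)"
  have small: "\<bar>of_rat m0 - (\<Sum>j<r. of_rat (m j) * \<beta> j)\<bar> \<le> S * (1 / real Q)" if Q: "Q \<ge> max Q0 1" for Q
  proof -
    have q1: "real_of_int (q Q) \<ge> 1" using q[of Q] Q by simp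
    have "of_rat (of_int (q Q) * m0) = (of_rat (\<Sum>j<r. of_int (p Q j) * m j) :: real)"
      using rel[of Q] Q by simp
    then have "of_int (q Q) * of_rat m0 = (\<Sum>j<r. of_int (p Q j) * (of_rat (m j) :: real))"
      by (simp add: of_rat_mult of_rat_sum)
    then have "of_int (q Q) * (of_rat m0 - (\<Sum>j<r. of_rat (m j) * \<beta> j))
        = (\<Sum>j<r. of_rat (m j) * (of_int (p Q j) - of_int (q Q) * \<beta> j))"
      by (simp add: algebra_simps sum_subtractf sum_distrib_left)
    note eq = this
    have "of_int (q Q) * \<bar>of_rat m0 - (\<Sum>j<r. of_rat (m j) * \<beta> j)\<bar>
        = \<bar>of_int (q Q) * (of_rat m0 - (\<Sum>j<r. of_rat (m j) * \<beta> j))\<bar>"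
      using q1 by (simp add: abs_mult)
    also have "\<dots> = \<bar>\<Sum>j<r. of_rat (m j) * (of_int (p Q j) - of_int (q Q) * \<beta> j)\<bar>"
      by (simp only: eq)
    also have "\<dots> \<le> (\<Sum>j<r. \<bar>of_rat (m j)\<bar> * (1 / real Q))"
    proof (rule order_trans[OF sum_abs sum_mono])
      fix j assume "j \<in> {..<r}"
      then have "\<bar>of_int (p Q j) - of_int (q Q) * \<beta> j\<bar> \<le> 1 / real Q"
        using approx[of Q j] Q by (auto simp: abs_minus_commute)
      then show "\<bar>of_rat (m j) * (of_int (p Q j) - of_int (q Q) * \<beta> j)\<bar> \<le> \<bar>of_rat (m j)\<bar> * (1 / real Q)"
        unfolding abs_mult by (intro mult_left_mono) auto
    qed
    also have "\<dots> = S * (1 / real Q)" by (simp only: S_def sum_distrib_right)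
    finally have "of_int (q Q) * \<bar>of_rat m0 - (\<Sum>j<r. of_rat (m j) * \<beta> j)\<bar> \<le> S * (1 / real Q)" .
    moreover have "\<bar>of_rat m0 - (\<Sum>j<r. of_rat (m j) * \<beta> j)\<bar>
        \<le> of_int (q Q) * \<bar>of_rat m0 - (\<Sum>j<r. of_rat (m j) * \<beta> j)\<bar>"
      using mult_right_mono[OF q1, of "\<bar>of_rat m0 - (\<Sum>j<r. of_rat (m j) * \<beta> j)\<bar>"] by simp
    ultimately show ?thesis by (rule order_trans[rotated])
  qed
  have "(\<lambda>Q::nat. S * (1 / real Q)) \<longlonglongrightarrow> S * 0"
    by (intro tendsto_mult tendsto_const lim_1_over_n)
  then have "\<bar>of_rat m0 - (\<Sum>j<r. of_rat (m j) * \<beta> j)\<bar> \<le> S * 0"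
    by (rule LIMSEQ_le_const) (use small in blast)
  then have "of_rat m0 = (\<Sum>j<r. of_rat (m j) * \<beta> j)" by simp
  then have "m j0 = 0" using indep j0(1) by blast
  then show False using f(4) by (simp add: m_def)
qed

text \<open>
Modulo \<open>g\<close> the orbit \<open>y\<close> is an integer combination of the independent angles \<open>\<beta>\<^sub>j\<close>, up to the scaling
\<open>\<theta>\<close>. For \<open>q\<close> from Dirichlet's theorem, \<open>q \<theta> y\<^sub>k\<close> is modulo 1 the value \<open>G k\<close> of a walk with steps
\<open>O(1/Q)\<close>. An unbounded walk crosses an arc of length \<open>1/4\<close> and cannot jump over its subarcs of
length \<open>O(1/Q)\<close>. Points of \<open>y\<close> for different subarcs differ modulo \<open>g\<close> by at least a constant times
\<open>1/(q Q)\<close>, hence a constant times \<open>Q\<^sup>-\<^sup>r\<^sup>-\<^sup>1\<close>.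
\<close>

lemma slow_walk_exponent:
  fixes y \<beta> :: "nat \<Rightarrow> real" and g \<theta> :: real and C :: "nat \<Rightarrow> nat \<Rightarrow> int" and Z :: "nat \<Rightarrow> int" and A D :: int
  assumes \<theta>: "\<theta> > 0" "g * \<theta> = of_int D"
    and y: "\<And>k. \<theta> * y k = of_int (Z k) + (\<Sum>j<r. of_int (C k j) * \<beta> j)"
    and step: "\<And>k j. j < r \<Longrightarrow> \<bar>C (Suc k) j - C k j\<bar> \<le> A"
    and indep: "\<And>m0 m. of_rat m0 = (\<Sum>j<r. of_rat (m j) * \<beta> j) \<Longrightarrow> \<forall>j<r. m j = (0::rat)"
    and j0: "j0 < r" "\<not> (\<exists>B. \<forall>k. \<bar>real_of_int (C k j0)\<bar> \<le> B)"
    and col: "colouring_exponent UNIV (\<lambda>\<delta> k k'. \<exists>n::int. \<bar>y k - y k' - of_int n * g\<bar> \<le> \<delta>) \<sigma>"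
  shows "1 \<le> \<sigma> * (real r + 1)"
proof -
  have "\<exists>q p. Q \<ge> 1 \<longrightarrow> (1 \<le> q \<and> q \<le> int (Q ^ r) \<and> (\<forall>j<r. \<bar>of_int q * \<beta> j - of_int (p j)\<bar> \<le> 1 / real Q))" for Q
  proof (cases "Q \<ge> 1")
    case True
    then obtain q p where "0 < q" "q \<le> int (Q ^ r)" "\<And>j. j < r \<Longrightarrow> \<bar>of_int q * \<beta> j - of_int (p j)\<bar> < 1 / real Q"
      using Dirichlet_approx_simult[of Q r \<beta>] by (metis less_eq_Suc_le One_nat_def)
    then show ?thesis by (intro exI[of _ q] exI[of _ p]) (auto intro: less_imp_le)
  qed auto
  then obtain q :: "nat \<Rightarrow> int" and p :: "nat \<Rightarrow> nat \<Rightarrow> int" where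
    q: "\<And>Q. Q \<ge> 1 \<Longrightarrow> q Q \<ge> 1" "\<And>Q. Q \<ge> 1 \<Longrightarrow> q Q \<le> int (Q ^ r)" and
    p: "\<And>Q j. Q \<ge> 1 \<Longrightarrow> j < r \<Longrightarrow> \<bar>of_int (q Q) * \<beta> j - of_int (p Q j)\<bar> \<le> 1 / real Q"
    by metis
  have A: "A \<ge> 0" using step[OF j0(1), of 0] by linarith
  define a where "a = real r * of_int A + 1"
  have a: "a \<ge> 1" using A by (simp add: a_def)
  show ?thesis
  proof (rule colouring_exponent_lower_bound[OF col, where \<kappa> = "1 / (24 * a)" and \<kappa>' = "a / \<theta>"])
    show "real r + 1 > 0" "1 / (24 * a) > 0" "a / \<theta> > 0" using a \<theta> by auto
    fix Q0 :: nat
    have "\<exists>Q\<ge>max Q0 (nat \<lceil>24 * a\<rceil>).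
        \<not> (\<exists>B. \<forall>k. \<bar>\<Sum>j<r. of_int (C k j) * (of_int (q Q) * \<beta> j - of_int (p Q j))\<bar> \<le> B)"
      by (rule unbounded_along_approximations[where ?j0.0 = j0]) (rule indep j0 q(1) p; assumption)+
    then obtain Q where Q: "Q \<ge> max Q0 (nat \<lceil>24 * a\<rceil>)"
      "\<not> (\<exists>B. \<forall>k. \<bar>\<Sum>j<r. of_int (C k j) * (of_int (q Q) * \<beta> j - of_int (p Q j))\<bar> \<le> B)"
      by blast
    have Qa: "real Q \<ge> 24 * a" using Q(1) by linarith
    then have Q1: "Q \<ge> 1" using a by simp
    define G where "G k = (\<Sum>j<r. of_int (C k j) * (of_int (q Q) * \<beta> j - of_int (p Q j)))" for k
    define \<eta> where "\<eta> = a / real Q"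
    have \<eta>: "0 < \<eta>" "\<eta> \<le> 1 / 24" using Qa a Q1 by (auto simp: \<eta>_def field_simps)
    have Gstep: "\<bar>G (Suc k) - G k\<bar> \<le> \<eta>" for k
    proof -
      have "\<bar>G (Suc k) - G k\<bar> = \<bar>\<Sum>j<r. of_int (C (Suc k) j - C k j) * (of_int (q Q) * \<beta> j - of_int (p Q j))\<bar>"
        by (simp add: G_def sum_subtractf[symmetric] left_diff_distrib)
      also have "\<dots> \<le> (\<Sum>j<r. of_int A * (1 / real Q))"
      proof (rule order_trans[OF sum_abs sum_mono])
        fix j assume j: "j \<in> {..<r}"
        then have "\<bar>of_int (C (Suc k) j - C k j)\<bar> \<le> (of_int A :: real)"
          using step[of j k] by (metis lessThan_iff of_int_abs of_int_le_iff)
        then show "\<bar>of_int (C (Suc k) j - C k j) * (of_int (q Q) * \<beta> j - of_int (p Q j))\<bar> \<le> of_int A * (1 / real Q)"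
          unfolding abs_mult using p[OF Q1, of j] j A by (intro mult_mono) auto
      qed
      also have "\<dots> = real r * of_int A / real Q" by simp
      also have "\<dots> \<le> \<eta>" unfolding \<eta>_def a_def using Q1 by (intro divide_right_mono) auto
      finally show ?thesis .
    qed
    \<comment> \<open>The walk may leave upwards or downwards; its distance from the start
      treats both cases. Values of this distance in the interval from 0 to 1/4 ensure that two
      of the points are never congruent modulo 1 in a nontrivial way.\<close>
    define H where "H k = \<bar>G k - G 0\<bar>" for k
    have Hstep: "H (Suc k) \<le> H k + \<eta>" for k
      using Gstep[of k] unfolding H_def by linarith
    have reach: "\<exists>k. x \<le> H k \<and> H k \<le> x + \<eta>" if "x \<ge> 0" for x
    proof -
      obtain K where "\<bar>G K\<bar> > x + \<bar>G 0\<bar>" using Q(2) unfolding G_def[symmetric] by (meson not_le)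
      then have "x \<le> H K" unfolding H_def by linarith
      moreover have "H 0 \<le> x" using that by (simp add: H_def)
      ultimately show ?thesis
        using discrete_intermediate_value[of H x K \<eta>] Hstep \<eta>(1) by (metis less_imp_le)
    qed
    then have "\<exists>k. 3 * \<eta> * real m \<le> H k \<and> H k \<le> 3 * \<eta> * real m + \<eta>" for m :: nat
      using \<eta>(1) by simp
    then obtain f where f: "\<And>m. 3 * \<eta> * real m \<le> H (f m)" "\<And>m. H (f m) \<le> 3 * \<eta> * real m + \<eta>"
      by metis
    \<comment> \<open>The heights \<open>3 \<eta> m\<close> with \<open>m < M\<close> stay below
      \<open>1/4\<close>. Being hit with an error \<open>\<eta>\<close>, they give values at
      mutual distance at least \<open>2 \<eta>\<close>, whereas points of the same colour differ
      by at most \<open>\<eta>\<close>.\<close>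
    define M where "M = nat \<lfloor>real Q / (12 * a)\<rfloor>"
    have M: "real M \<le> real Q / (12 * a)" "real M \<ge> real Q / (12 * a) - 1"
      using a by (simp_all add: M_def)
    have "real Q / (12 * a) - 1 \<ge> 1 / (24 * a) * real Q"
      using Qa a by (simp add: field_simps)
    moreover have "\<not> (\<exists>n::int. \<bar>y (f m) - y (f m') - of_int n * g\<bar> \<le> a / \<theta> * real Q powr - (real r + 1))"
      if m: "m < M" "m' < M" "m \<noteq> m'" for m m'
    proof
      assume "\<exists>n::int. \<bar>y (f m) - y (f m') - of_int n * g\<bar> \<le> a / \<theta> * real Q powr - (real r + 1)"
      then obtain n :: int where n: "\<bar>y (f m) - y (f m') - of_int n * g\<bar> \<le> a / \<theta> * real Q powr - (real r + 1)" by blast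
      define z where "z = q Q * (Z (f m) - Z (f m') - n * D) + (\<Sum>j<r. (C (f m) j - C (f m') j) * p Q j)"
      have qy: "of_int (q Q) * \<theta> * y k = of_int (q Q * Z k) + of_int (\<Sum>j<r. C k j * p Q j) + G k" for k
      proof -
        have "of_int (q Q) * (\<theta> * y k) = of_int (q Q * Z k) + of_int (\<Sum>j<r. C k j * p Q j) + G k"
          unfolding y G_def by (simp add: algebra_simps sum_subtractf sum_distrib_left)
        then show ?thesis by (simp add: mult.assoc)
      qed
      have zero: "real_of_int (q Q) * of_int n * (g * \<theta> - of_int D) = 0" using \<theta>(2) by simp
      have "G (f m) - G (f m') + of_int z = of_int (q Q) * \<theta> * (y (f m) - y (f m') - of_int n * g)"
        using qy[of "f m"] qy[of "f m'"] zero
        by (simp add: z_def algebra_simps sum_subtractf)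
      then have "\<bar>G (f m) - G (f m') + of_int z\<bar> = of_int (q Q) * \<theta> * \<bar>y (f m) - y (f m') - of_int n * g\<bar>"
        using q(1)[OF Q1] \<theta>(1) by (simp add: abs_mult)
      also have "\<dots> \<le> real Q ^ r * \<theta> * (a / \<theta> * real Q powr - (real r + 1))"
      proof -
        have "real_of_int (q Q) \<le> real Q ^ r"
          using q(2)[OF Q1] by (metis of_int_le_iff of_int_of_nat_eq of_nat_power)
        then show ?thesis using n q(1)[OF Q1] \<theta>(1) by (intro mult_mono) auto
      qed
      also have "real Q powr - (real r + 1) = 1 / real Q ^ Suc r"
        using Q1 powr_realpow[of "real Q" "Suc r"]
        by (simp only: powr_minus_divide of_nat_Suc add.commute)
      also have "real Q ^ r * \<theta> * (a / \<theta> * (1 / real Q ^ Suc r)) = \<eta>"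
        using \<theta>(1) Q1 by (simp add: \<eta>_def field_simps)
      finally have z: "\<bar>G (f m) - G (f m') + of_int z\<bar> \<le> \<eta>" .
      have quarter: "H (f i) \<le> 1 / 4" if "i < M" for i
      proof -
        have "3 * \<eta> * real i + \<eta> \<le> 3 * \<eta> * real M"
        proof -
          have "real i + 1 \<le> real M" using that by simp
          then have "3 * \<eta> * (real i + 1) \<le> 3 * \<eta> * real M" using \<eta>(1) by (intro mult_left_mono) auto
          then show ?thesis using \<eta>(1) by (simp add: algebra_simps)
        qed
        also have "\<dots> \<le> 3 * \<eta> * (real Q / (12 * a))" using M(1) \<eta>(1) by (intro mult_left_mono) auto
        also have "\<dots> = 1 / 4" using a Q1 by (simp add: \<eta>_def)
        finally show ?thesis using f(2)[of i] by linarith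
      qed
      have "\<bar>real_of_int z\<bar> < 1"
        using quarter[OF m(1)] quarter[OF m(2)] z \<eta>(2) unfolding H_def by linarith
      then have "z = 0" by linarith
      with z have "\<bar>H (f m) - H (f m')\<bar> \<le> \<eta>" unfolding H_def by simp
      moreover have "\<bar>H (f m) - H (f m')\<bar> \<ge> 2 * \<eta>"
      proof -
        have aux: "H (f i') - H (f i) \<ge> 2 * \<eta>" if "i < i'" for i i'
        proof -
          have "real i + 1 \<le> real i'" using that by simp
          then have "3 * \<eta> * (real i + 1) \<le> 3 * \<eta> * real i'" using \<eta>(1) by (intro mult_left_mono) auto
          then show ?thesis using f(1)[of i'] f(2)[of i] by (simp add: algebra_simps)
        qed
        from m(3) have "m < m' \<or> m' < m" by linarith
        then show ?thesis using aux[of m m'] aux[of m' m] by (elim disjE) linarith+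
      qed
      ultimately show False using \<eta>(1) by linarith
    qed
    ultimately show "\<exists>Q M f. Q0 \<le> Q \<and> 1 / (24 * a) * real Q \<le> real M \<and> (\<forall>m<M. f m \<in> UNIV) \<and>
       (\<forall>m<M. \<forall>m'<M. m \<noteq> m' \<longrightarrow> \<not> (\<exists>n::int. \<bar>y (f m) - y (f m') - of_int n * g\<bar> \<le> a / \<theta> * real Q powr - (real r + 1)))"
      using M(2) Q(1) by (intro exI[of _ Q] exI[of _ M] exI[of _ f]) auto
  qed
qed

section \<open>Rotations by two angles\<close>

text \<open>
The orbit is dense in the circle, so for each \<open>m\<close> it has a point within \<open>1/(4 M)\<close> of \<open>m/M\<close>.
\<close>

lemma irrational_rotation_spread:
  fixes \<theta> :: real
  assumes "\<theta> \<notin> \<rat>" "M \<ge> 1"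
  obtains f :: "nat \<Rightarrow> nat" where
    "\<And>m m' n. m < M \<Longrightarrow> m' < M \<Longrightarrow> m \<noteq> m' \<Longrightarrow>
      1 / (2 * real M) \<le> \<bar>(real (f m) - real (f m')) * \<theta> - of_int n\<bar>"
proof -
  have "\<exists>k. m < M \<longrightarrow> \<bar>frac (real k * \<theta>) - real m / real M\<bar> < 1 / (4 * real M)" for m
  proof (cases "m < M")
    case True
    obtain k where "\<bar>frac (real k * \<theta>) - real m / real M\<bar> < 1 / (4 * real M)"
      by (rule Kronecker_approx_1_explicit[OF assms(1), of "real m / real M" "1 / (4 * real M)"])
         (use True assms in auto)
    then show ?thesis by blast
  qed auto
  then obtain f where f: "\<And>m. m < M \<Longrightarrow> \<bar>frac (real (f m) * \<theta>) - real m / real M\<bar> < 1 / (4 * real M)"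
    by metis
  show thesis
  proof
    fix m m' and n :: int assume m: "m < M" "m' < M" "m \<noteq> m'"
    define d where "d = int m - int m' + int M * (\<lfloor>real (f m) * \<theta>\<rfloor> - \<lfloor>real (f m') * \<theta>\<rfloor> - n)"
    have "d \<noteq> 0"
    proof
      assume "d = 0"
      then have "int m - int m' = int M * (n - \<lfloor>real (f m) * \<theta>\<rfloor> + \<lfloor>real (f m') * \<theta>\<rfloor>)"
        by (simp add: d_def algebra_simps)
      then have "int M dvd int m - int m'" by simp
      then have "\<bar>int m - int m'\<bar> \<ge> int M"
        using m(3) by (metis abs_of_nat dvd_imp_le_int eq_iff_diff_eq_0 of_nat_eq_iff)
      then show False using m by linarith
    qed
    then have d: "\<bar>real_of_int d\<bar> \<ge> 1" by linarith
    have M: "real M > 0" using assms(2) by simp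
    define e where "e = (real (f m) - real (f m')) * \<theta> - of_int n"
    have "e - of_int d / real M
        = (frac (real (f m) * \<theta>) - real m / real M) - (frac (real (f m') * \<theta>) - real m' / real M)"
      using M by (simp add: e_def d_def frac_def field_simps)
    then have "\<bar>e - of_int d / real M\<bar> \<le> 1 / (2 * real M)"
      using f[OF m(1)] f[OF m(2)] by (simp add: abs_if split: if_splits)
    moreover have "\<bar>of_int d / real M\<bar> \<ge> 1 / real M"
      using d M by (simp add: divide_right_mono)
    moreover have "1 / real M = 1 / (2 * real M) + 1 / (2 * real M)" by simp
    ultimately show "1 / (2 * real M) \<le> \<bar>(real (f m) - real (f m')) * \<theta> - of_int n\<bar>"
      unfolding e_def[symmetric] by linarith
  qed
qed

text \<open>
For fixed \<open>p\<close> the number of second letters in a window of length \<open>p\<close> changes by at most one when the window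
moves by one place, so it attains every value between its extremes. Therefore \<open>y\<^sub>k\<^sub>+\<^sub>p - y\<^sub>k\<close> runs
through as long a stretch of an orbit of the rotation by \<open>\<theta>\<close> as desired, which comes close to all points
of the circle. A pair of colours determines the difference, and this doubles the exponent.
\<close>

lemma two_letter_exponent_unbounded_discrepancy:
  fixes a1 \<theta> g :: real and m :: "nat \<Rightarrow> int"
  assumes g: "g > 0" and irr: "\<theta> / g \<notin> \<rat>"
    and m: "\<And>k. m (Suc k) = m k \<or> m (Suc k) = m k + 1"
    and y: "\<And>k. y k = real k * a1 + of_int (m k) * \<theta>"
    and unb: "\<And>J. \<exists>p k k'. J \<le> (m (k + p) - m k) - (m (k' + p) - m k')"
    and col: "colouring_exponent UNIV (\<lambda>\<delta> k k'. \<exists>n::int. \<bar>y k - y k' - of_int n * g\<bar> \<le> \<delta>) \<sigma>"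
  shows "1 \<le> 2 * \<sigma>"
proof -
  let ?close = "\<lambda>\<delta> k k'. \<exists>n::int. \<bar>y k - y k' - of_int n * g\<bar> \<le> \<delta>"
  have col2: "colouring_exponent (UNIV :: (nat \<times> nat) set)
      (\<lambda>\<delta> x x'. ?close \<delta> (fst x) (fst x') \<and> ?close \<delta> (snd x) (snd x')) (\<sigma> + \<sigma>)"
    by (intro colouring_exponent_conj colouring_exponent_pullback[OF col]) auto
  have "1 \<le> (\<sigma> + \<sigma>) * 1"
  proof (rule colouring_exponent_lower_bound[OF col2, where \<kappa> = 1 and \<kappa>' = "g / 5"])
    fix Q0 :: nat
    define M where "M = Suc Q0"
    obtain f :: "nat \<Rightarrow> nat" where f: "\<And>i i' n. i < M \<Longrightarrow> i' < M \<Longrightarrow> i \<noteq> i' \<Longrightarrow>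
      1 / (2 * real M) \<le> \<bar>(real (f i) - real (f i')) * (\<theta> / g) - of_int n\<bar>"
      using irrational_rotation_spread[OF irr, of M] by (metis M_def le_add1 plus_1_eq_Suc)
    define J where "J = Max (f ` {..<M})"
    have J: "f i \<le> J" if "i < M" for i unfolding J_def using that by (intro Max_ge) auto
    obtain p k k' where pk: "int J \<le> (m (k + p) - m k) - (m (k' + p) - m k')" using unb by blast
    define b where "b i = m (i + p) - m i" for i
    have bstep: "\<bar>b (Suc i) - b i\<bar> \<le> 1" for i
      using m[of i] m[of "i + p"] by (auto simp: b_def)
    have hit: "\<exists>i. b i = x" if x: "b k' \<le> x" "x \<le> b k" for x
    proof (cases "k' \<le> k")
      case True
      then show ?thesis
        using nat_intermed_int_val[of k' k b x] bstep x by blast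
    next
      case False
      have "\<bar>- b (Suc i) - - b i\<bar> \<le> 1" for i using bstep[of i] by linarith
      then have "\<exists>i. k \<le> i \<and> i \<le> k' \<and> - b i = - x"
        using nat_intermed_int_val[of k k' "\<lambda>i. - b i" "- x"] False x by simp
      then show ?thesis by auto
    qed
    have "\<exists>i. b i = b k' + int (f j)" if "j < M" for j
      using pk J[OF that] by (intro hit) (auto simp: b_def)
    then obtain h where h: "\<And>j. j < M \<Longrightarrow> b (h j) = b k' + int (f j)" by metis
    have "\<not> (?close (g / 5 * real M powr - 1) (h i + p) (h i' + p) \<and> ?close (g / 5 * real M powr - 1) (h i) (h i'))"
      if i: "i < M" "i' < M" "i \<noteq> i'" for i i'
    proof
      have pw: "real M powr - 1 = 1 / real M" by (simp add: powr_minus_divide M_def)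
      assume "?close (g / 5 * real M powr - 1) (h i + p) (h i' + p) \<and> ?close (g / 5 * real M powr - 1) (h i) (h i')"
      then obtain n1 n2 :: int where n: "\<bar>y (h i + p) - y (h i' + p) - of_int n1 * g\<bar> \<le> g / 5 * (1 / real M)"
        "\<bar>y (h i) - y (h i') - of_int n2 * g\<bar> \<le> g / 5 * (1 / real M)"
        unfolding pw by blast
      have yb: "y (j + p) - y j = real p * a1 + of_int (b j) * \<theta>" for j
        by (simp add: y b_def algebra_simps)
      have "(real (f i) - real (f i')) * \<theta> = (y (h i + p) - y (h i)) - (y (h i' + p) - y (h i'))"
        unfolding yb using h[OF i(1)] h[OF i(2)] by (simp add: algebra_simps)
      then have "\<bar>(real (f i) - real (f i')) * \<theta> - of_int (n1 - n2) * g\<bar> \<le> 2 * (g / 5 * (1 / real M))"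
        using n by (simp add: abs_if left_diff_distrib split: if_splits)
      moreover have "(real (f i) - real (f i')) * \<theta> - of_int (n1 - n2) * g
          = g * ((real (f i) - real (f i')) * (\<theta> / g) - of_int (n1 - n2))"
        using g by (simp add: field_simps)
      ultimately have "g * \<bar>(real (f i) - real (f i')) * (\<theta> / g) - of_int (n1 - n2)\<bar> \<le> g * (2 / 5 * (1 / real M))"
        using g by (simp add: abs_mult)
      then have "\<bar>(real (f i) - real (f i')) * (\<theta> / g) - of_int (n1 - n2)\<bar> \<le> 2 / 5 * (1 / real M)"
        using g by (simp only: mult_le_cancel_left_pos)
      moreover have "2 / 5 * (1 / real M) < 1 / (2 * real M)" by (simp add: M_def field_simps)
      ultimately show False using f[OF i, of "n1 - n2"] by (meson leD le_less_trans)
    qed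
    then show "\<exists>Q M f. Q0 \<le> Q \<and> 1 * real Q \<le> real M \<and> (\<forall>m<M. f m \<in> UNIV) \<and>
       (\<forall>m<M. \<forall>m'<M. m \<noteq> m' \<longrightarrow> \<not> (?close (g / 5 * real Q powr - 1) (fst (f m)) (fst (f m')) \<and>
          ?close (g / 5 * real Q powr - 1) (snd (f m)) (snd (f m'))))"
      by (intro exI[of _ M] exI[of _ "\<lambda>i. (h i + p, h i)"]) (auto simp: M_def)
  qed (use g in auto)
  then show ?thesis by simp
qed

text \<open>
The sequence is additive up to \<open>J\<close>, so the intervals of radius \<open>J/p\<close> about \<open>m p / p\<close> intersect pairwise:
compare \<open>m (p p')\<close> with both \<open>p' m p\<close> and \<open>p m p'\<close>. The supremum of their left endpoints lies in all of
them.
\<close>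

lemma bounded_discrepancy_frequency:
  fixes m :: "nat \<Rightarrow> int"
  assumes m0: "m 0 = 0" and J: "\<And>p k k'. (m (k + p) - m k) - (m (k' + p) - m k') \<le> J"
  obtains f :: real where "\<And>p. \<bar>of_int (m p) - f * real p\<bar> \<le> of_int J"
proof -
  have mult: "\<bar>m (n * p) - int n * m p\<bar> \<le> int n * J" for n p
  proof (induction n)
    case (Suc n)
    have "(m (n * p + p) - m (n * p)) - (m (0 + p) - m 0) \<le> J"
         "(m (0 + p) - m 0) - (m (n * p + p) - m (n * p)) \<le> J"
      by (rule J)+
    then have "\<bar>m (n * p + p) - m (n * p) - m p\<bar> \<le> J" using m0 by auto
    then show ?case using Suc by (simp add: algebra_simps)
  qed (use m0 in simp)
  have cmp: "(of_int (m p) - of_int J) / real p \<le> (of_int (m p') + of_int J) / real p'"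
    if "p \<ge> 1" "p' \<ge> 1" for p p'
  proof -
    have "int p' * m p - int p' * J \<le> m (p' * p)" using mult[of p' p] by linarith
    also have "\<dots> \<le> int p * m p' + int p * J" using mult[of p p'] by (simp add: mult.commute)
    finally have "real_of_int (int p' * m p - int p' * J) \<le> real_of_int (int p * m p' + int p * J)"
      by (simp only: of_int_le_iff)
    then show ?thesis using that by (simp add: field_simps)
  qed
  define f where "f = (SUP p\<in>{1..}. (of_int (m p) - of_int J) / real p)"
  have bdd: "bdd_above ((\<lambda>p. (of_int (m p) - of_int J) / real p) ` {1..})"
    by (rule bdd_aboveI2[where M = "(of_int (m 1) + of_int J) / real 1"], rule cmp) auto
  show thesis
  proof
    fix p :: nat
    show "\<bar>of_int (m p) - f * real p\<bar> \<le> of_int J"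
    proof (cases "p \<ge> 1")
      case True
      have "(of_int (m p) - of_int J) / real p \<le> f"
        unfolding f_def using True bdd by (intro cSUP_upper) auto
      moreover have "f \<le> (of_int (m p) + of_int J) / real p"
        unfolding f_def using True cmp by (intro cSUP_least) auto
      ultimately show ?thesis using True by (simp add: field_simps abs_le_iff)
    next
      case False
      have "0 \<le> J" using J[of 0 0 0] by simp
      then show ?thesis using False m0 by (simp add: not_le)
    qed
  qed
qed

text \<open>
Let \<open>f\<close> be the frequency of the second letter. If \<open>q \<theta>/g\<close> is within \<open>1/Q\<close> of the integer \<open>p\<close>, then
modulo 1 the number \<open>q y\<^sub>k / g\<close> differs by \<open>O(1/Q)\<close> from \<open>k \<omega>\<close>, where \<open>\<omega> = q (a\<^sub>1 + f \<theta>)/g - p f\<close>. If \<open>\<omega>\<close> is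
irrational, then this rotation visits of the order of \<open>Q\<close> separate arcs of length \<open>1/Q\<close>, and so the orbit \<open>y\<close> has that
many values at scale \<open>Q\<^sup>-\<^sup>2\<close>.
\<close>

lemma two_letter_exponent_bounded_discrepancy:
  fixes a1 \<theta> g :: real and m :: "nat \<Rightarrow> int"
  assumes g: "g > 0" and indep: "\<And>u v w. of_rat u * a1 + of_rat v * (a1 + \<theta>) = of_rat w * g \<Longrightarrow> u = 0 \<and> v = 0"
    and m0: "m 0 = 0"
    and y: "\<And>k. y k = real k * a1 + of_int (m k) * \<theta>"
    and J: "\<And>p k k'. (m (k + p) - m k) - (m (k' + p) - m k') \<le> J"
    and col: "colouring_exponent UNIV (\<lambda>\<delta> k k'. \<exists>n::int. \<bar>y k - y k' - of_int n * g\<bar> \<le> \<delta>) \<sigma>"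
  shows "1 \<le> \<sigma> * 2"
proof (rule colouring_exponent_lower_bound[OF col])
  obtain f :: real where f: "\<And>p. \<bar>of_int (m p) - f * real p\<bar> \<le> of_int J"
    using bounded_discrepancy_frequency[OF m0 J] by blast
  have J0: "J \<ge> 0" using J[of 0 0 0] by simp
  define A where "A = (a1 + f * \<theta>) / g"
  have not_both: "\<not> (A \<in> \<rat> \<and> f \<in> \<rat>)"
  proof
    assume "A \<in> \<rat> \<and> f \<in> \<rat>"
    then obtain u v where uv: "A = of_rat u" "f = of_rat v" by (auto elim!: Rats_cases)
    have "A * g = a1 + f * \<theta>" using g by (simp add: A_def)
    then have "of_rat (1 - v) * a1 + of_rat v * (a1 + \<theta>) = A * g"
      by (simp add: uv(2)[symmetric] of_rat_diff algebra_simps)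
    then have "1 - v = 0 \<and> v = 0" unfolding uv(1) by (rule indep)
    then show False by auto
  qed
  have irr: "\<theta> / g \<notin> \<rat>"
  proof
    assume "\<theta> / g \<in> \<rat>"
    then obtain w where "\<theta> / g = of_rat w" by (auto elim!: Rats_cases)
    then have "of_rat (- 1) * a1 + of_rat 1 * (a1 + \<theta>) = of_rat w * g"
      using g by (simp add: field_simps of_rat_minus)
    then have "(- 1 :: rat) = 0 \<and> (1 :: rat) = 0" by (rule indep)
          then show False by simp
  qed
  have "\<exists>q p. Q \<ge> 1 \<longrightarrow> (1 \<le> q \<and> q \<le> int Q \<and> \<bar>of_int q * (\<theta> / g) - of_int p\<bar> < 1 / real Q)" for Q :: nat
  proof (cases "Q \<ge> 1")
    case True
    then obtain p q where "0 < q" "q \<le> int Q" "\<bar>of_int q * (\<theta> / g) - of_int p\<bar> < 1 / real Q"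
      using Dirichlet_approx[of Q "\<theta> / g"] by (metis less_eq_Suc_le One_nat_def)
    then show ?thesis by (intro exI[of _ q] exI[of _ p]) auto
  qed auto
  then obtain q p :: "nat \<Rightarrow> int" where
    q: "\<And>Q. Q \<ge> 1 \<Longrightarrow> q Q \<ge> 1" "\<And>Q. Q \<ge> 1 \<Longrightarrow> q Q \<le> int Q" and
    p: "\<And>Q. Q \<ge> 1 \<Longrightarrow> \<bar>of_int (q Q) * (\<theta> / g) - of_int (p Q)\<bar> < 1 / real Q"
    by metis
  \<comment> \<open>If all these angles were rational, two approximations with different
    quotients would make both the frequency and the mean step divided by \<open>g\<close>
    rational, and then a relation between the two letters and \<open>g\<close> would hold. If
    all quotients agree, \<open>\<theta>/g\<close> equals that quotient.\<close>
  have exQ: "\<exists>Q\<ge>Q0. of_int (q Q) * A - of_int (p Q) * f \<notin> \<rat>" if "Q0 \<ge> 1" for Q0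
  proof (rule ccontr)
    assume "\<not> ?thesis"
    then have rat: "of_int (q Q) * A - of_int (p Q) * f \<in> \<rat>" if "Q \<ge> Q0" for Q using that by blast
    have par: "of_int (p Q) = of_int (q Q) * (of_int (p Q0) / of_int (q Q0) :: real)" if Q: "Q \<ge> Q0" for Q
    proof (rule ccontr)
      assume ne: "\<not> ?thesis"
      have qp: "real_of_int (q Q0) > 0" "real_of_int (q Q) > 0" using q(1)[of Q0] q(1)[of Q] \<open>Q0 \<ge> 1\<close> Q by linarith+
      define D where "D = q Q * p Q0 - q Q0 * p Q"
      have D: "real_of_int D \<noteq> 0" using ne qp by (simp add: D_def field_simps flip: of_int_mult)
      have "of_int (q Q) * (of_int (q Q0) * A - of_int (p Q0) * f) - of_int (q Q0) * (of_int (q Q) * A - of_int (p Q) * f) \<in> \<rat>"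
        by (intro Rats_diff[OF Rats_mult Rats_mult] Rats_of_int rat) (use Q in auto)
      also have "of_int (q Q) * (of_int (q Q0) * A - of_int (p Q0) * f) - of_int (q Q0) * (of_int (q Q) * A - of_int (p Q) * f)
         = - of_int D * f" by (simp add: D_def algebra_simps)
      finally have "- of_int D * f / (- of_int D) \<in> \<rat>" by (intro Rats_divide) auto
      then have fr: "f \<in> \<rat>" using D by simp
      then have "(of_int (q Q0) * A - of_int (p Q0) * f + of_int (p Q0) * f) / of_int (q Q0) \<in> \<rat>"
        by (intro Rats_divide[OF Rats_add] Rats_mult Rats_of_int rat) auto
      then have "A \<in> \<rat>" using qp by simp
      with fr not_both show False by blast
    qed
    define x where "x = \<bar>\<theta> / g - of_int (p Q0) / of_int (q Q0)\<bar>"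
    have "x \<le> 1 / real Q" if Q: "Q \<ge> Q0" for Q
    proof -
      have q1: "real_of_int (q Q) \<ge> 1" using q(1)[of Q] \<open>Q0 \<ge> 1\<close> Q by linarith
      have "of_int (q Q) * (\<theta> / g) - of_int (p Q) = of_int (q Q) * (\<theta> / g - of_int (p Q0) / of_int (q Q0))"
        by (simp add: par[OF Q] right_diff_distrib)
      then have "of_int (q Q) * x < 1 / real Q"
        using p[of Q] Q \<open>Q0 \<ge> 1\<close> q1 by (simp add: x_def abs_mult)
      moreover have "x \<le> of_int (q Q) * x" using mult_right_mono[OF q1, of x] by (simp add: x_def)
      ultimately show ?thesis by linarith
    qed
    then have "x \<le> 0" by (intro LIMSEQ_le_const[OF lim_1_over_n]) blast
    then have "\<theta> / g = of_int (p Q0) / of_int (q Q0)" by (simp add: x_def)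
    then show False using irr by auto
  qed
  define \<kappa> where "\<kappa> = 1 / (16 * (real_of_int J + 1))"
  show "(2::real) > 0" "\<kappa> > 0" "g > 0" using J0 g by (auto simp: \<kappa>_def)
  fix Q0 :: nat
  define Q1 where "Q1 = max Q0 (16 * (nat J + 1))"
  have "Q1 \<ge> 1" by (simp add: Q1_def)
  then obtain Q where Q: "Q \<ge> Q1" and om: "of_int (q Q) * A - of_int (p Q) * f \<notin> \<rat>"
    using exQ[of Q1] by blast
  have Qpos: "Q \<ge> 1" using Q \<open>Q1 \<ge> 1\<close> by simp
  define \<omega> where "\<omega> = of_int (q Q) * A - of_int (p Q) * f"
  define s where "s = of_int (q Q) * (\<theta> / g) - of_int (p Q)"
  have "int Q \<ge> 16 * (J + 1)" 
  proof -
    have "16 * (nat J + 1) \<le> Q" using Q by (simp add: Q1_def)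
    then have "int (16 * (nat J + 1)) \<le> int Q" by (simp only: of_nat_le_iff)
    then show ?thesis using J0 by simp
  qed
  then have "real_of_int (int Q) \<ge> real_of_int (16 * (J + 1))" by (simp only: of_int_le_iff)
  then have QJ: "real Q \<ge> 16 * (of_int J + 1)" by simp
  define M where "M = nat \<lfloor>real Q / (8 * (of_int J + 1))\<rfloor>"
  have M: "real M \<le> real Q / (8 * (of_int J + 1))" "real M \<ge> real Q / (8 * (of_int J + 1)) - 1"
    using J0 by (simp_all add: M_def)
  have "real Q / (8 * (of_int J + 1)) - 1 \<ge> \<kappa> * real Q"
  proof -
    define x where "x = real Q / (16 * (of_int J + 1))"
    have x: "x \<ge> 1" using QJ J0 by (simp add: x_def le_divide_eq)
    have eq: "real Q / (8 * (of_int J + 1)) = 2 * x" "\<kappa> * real Q = x"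
      using J0 by (simp_all add: x_def \<kappa>_def divide_simps)
    show ?thesis unfolding eq using x by linarith
  qed
  then have M\<kappa>: "\<kappa> * real Q \<le> real M" using M(2) by linarith
  have "real M > 0" using M\<kappa> Qpos J0 by (smt (verit) \<open>\<kappa> > 0\<close> mult_pos_pos of_nat_0_less_iff less_eq_Suc_le One_nat_def)
  then have M1: "M \<ge> 1" by simp
  obtain h :: "nat \<Rightarrow> nat" where h: "\<And>i i' n. i < M \<Longrightarrow> i' < M \<Longrightarrow> i \<noteq> i' \<Longrightarrow>
      1 / (2 * real M) \<le> \<bar>(real (h i) - real (h i')) * \<omega> - of_int n\<bar>"
    using irrational_rotation_spread[OF om M1] unfolding \<omega>_def by blast
  have "\<not> (\<exists>n::int. \<bar>y (h i) - y (h i') - of_int n * g\<bar> \<le> g * real Q powr - 2)"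
    if i: "i < M" "i' < M" "i \<noteq> i'" for i i'
  proof
    assume "\<exists>n::int. \<bar>y (h i) - y (h i') - of_int n * g\<bar> \<le> g * real Q powr - 2"
    then obtain n :: int where n: "\<bar>y (h i) - y (h i') - of_int n * g\<bar> \<le> g * real Q powr - 2" by blast
    define b where "b k = of_int (m k) - f * real k" for k
    have b: "\<bar>b k * s\<bar> \<le> of_int J * (1 / real Q)" for k
      unfolding abs_mult b_def s_def using f[of k] p[OF Qpos] J0 by (intro mult_mono) auto
    have qy: "of_int (q Q) / g * y k = real k * \<omega> + of_int (m k * p Q) + b k * s" for k
      using g by (simp add: y \<omega>_def A_def b_def s_def field_simps)
    define z where "z = (m (h i) - m (h i')) * p Q - n * q Q"
    have "(real (h i) - real (h i')) * \<omega> + of_int z + (b (h i) * s - b (h i') * s)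
        = of_int (q Q) / g * (y (h i) - y (h i') - of_int n * g)"
      using qy[of "h i"] qy[of "h i'"] g by (simp add: z_def algebra_simps)
    then have "\<bar>(real (h i) - real (h i')) * \<omega> + of_int z + (b (h i) * s - b (h i') * s)\<bar>
        = of_int (q Q) / g * \<bar>y (h i) - y (h i') - of_int n * g\<bar>"
      using g q(1)[OF Qpos] by (simp add: abs_mult)
    also have "\<dots> \<le> real Q / g * (g * real Q powr - 2)"
    proof -
      have "real_of_int (q Q) \<le> real Q" using q(2)[OF Qpos] by linarith
      then show ?thesis using n g q(1)[OF Qpos] by (intro mult_mono divide_right_mono) auto
    qed
    also have "real Q powr - 2 = 1 / (real Q * real Q)"
      using Qpos powr_realpow[of "real Q" 2] by (simp add: powr_minus_divide power2_eq_square)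
    also have "real Q / g * (g * (1 / (real Q * real Q))) = 1 / real Q" using g Qpos by simp
    finally have "\<bar>(real (h i) - real (h i')) * \<omega> - of_int (- z)\<bar> \<le> 1 / real Q + 2 * (of_int J * (1 / real Q))"
      using b[of "h i"] b[of "h i'"] by (simp add: abs_le_iff)
    also have "\<dots> < 4 * (of_int J + 1) * (1 / real Q)"
    proof -
      have "1 / real Q > 0" using Qpos by simp
      then have "(1 + 2 * of_int J) * (1 / real Q) < 4 * (of_int J + 1) * (1 / real Q)"
        using J0 by (intro mult_strict_right_mono) auto
      then show ?thesis by (simp add: algebra_simps)
    qed
    also have "\<dots> \<le> 1 / (2 * real M)"
    proof -
      have "real M * (8 * (of_int J + 1)) \<le> real Q" using M(1) J0 by (simp add: field_simps)
      then show ?thesis using \<open>real M > 0\<close> Qpos by (simp add: field_simps)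
    qed
    finally show False using h[OF i, of "- z"] by linarith
  qed
  then show "\<exists>Q M f. Q0 \<le> Q \<and> \<kappa> * real Q \<le> real M \<and> (\<forall>m<M. f m \<in> UNIV) \<and>
     (\<forall>m<M. \<forall>m'<M. m \<noteq> m' \<longrightarrow> \<not> (\<exists>n::int. \<bar>y (f m) - y (f m') - of_int n * g\<bar> \<le> g * real Q powr - 2))"
    using M\<kappa> Q unfolding Q1_def by (intro exI[of _ Q] exI[of _ M] exI[of _ h]) auto
qed

section \<open>Multi-rotation orbits\<close>

lemma common_denominator:
  fixes F :: "rat set"
  assumes "finite F"
  obtains D :: int where "D > 0" "\<And>x. x \<in> F \<Longrightarrow> of_int D * x \<in> \<int>"
proof -
  have "\<exists>D::int. D > 0 \<and> (\<forall>x\<in>F. of_int D * x \<in> \<int>)"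
    using assms
  proof induction
    case empty
    show ?case by (intro exI[of _ 1]) simp
  next
    case (insert x F)
    then obtain D :: int where D: "D > 0" "\<forall>x\<in>F. of_int D * x \<in> \<int>" by blast
    obtain a b where ab: "quotient_of x = (a, b)" by fastforce
    then have b: "b > 0" and x: "x = of_int a / of_int b"
      by (auto simp: quotient_of_denom_pos quotient_of_div)
    have "of_int (D * b) * x = of_int (D * a)" using b by (simp add: x)
    then have "of_int (D * b) * x \<in> \<int>" by (metis Ints_of_int)
    moreover have "of_int (D * b) * y \<in> \<int>" if "y \<in> F" for y
    proof -
      have "of_int b * (of_int D * y) \<in> \<int>"
        by (rule Ints_mult[OF Ints_of_int]) (use D(2) that in blast)
      then show ?thesis by (simp add: mult_ac)
    qed
    ultimately show ?case using D b by (intro exI[of _ "D * b"]) auto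
  qed
  with that show thesis by blast
qed

text \<open>
The set \<open>B\<close> completes \<open>g\<close> to a rational basis of the span of \<open>g\<close> and the steps; after clearing
denominators, \<open>slow_walk_exponent\<close> applies to the integer coordinates \<open>C\<close> of the orbit. They are unbounded: otherwise
two of the coordinate vectors agree, the steps taken between these two times add up to a rational
multiple of \<open>g\<close>, and since every step is positive and is counted a non-negative number of times, \<open>g\<close>
lies in the cone.
\<close>

lemma multi_rotation_exponent_rank:
  fixes a :: "nat \<Rightarrow> real" and \<iota> :: "nat \<Rightarrow> nat" and g :: real
  assumes a: "\<And>i. i \<in> {1..l} \<Longrightarrow> 0 < a i" and \<iota>: "\<And>k. \<iota> k \<in> {1..l}" and g: "g > 0"
    and nocone: "\<not> (\<exists>t :: nat \<Rightarrow> rat. (\<forall>i\<in>{1..l}. 0 \<le> t i) \<and> g = (\<Sum>i\<in>{1..l}. of_rat (t i) * a i))"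
    and y: "\<And>k. y k = (\<Sum>s<k. a (\<iota> s))"
    and col: "colouring_exponent UNIV (\<lambda>\<delta> k k'. \<exists>n::int. \<bar>y k - y k' - of_int n * g\<bar> \<le> \<delta>) \<sigma>"
  obtains B where "B \<subseteq> a ` {1..l}" "g \<notin> B" "rat_vs.independent (insert g B)" "1 \<le> \<sigma> * (real (card B) + 1)"
proof -
  let ?S = "insert g (a ` {1..l})"
  have "rat_vs.independent {g}" using g by simp
  then obtain B0 where B0: "{g} \<subseteq> B0" "B0 \<subseteq> ?S" "rat_vs.independent B0" "?S \<subseteq> rat_vs.span B0"
    using rat_vs.maximal_independent_subset_extend[of "{g}" ?S] by auto
  define B where "B = B0 - {g}"
  have B: "B \<subseteq> a ` {1..l}" "g \<notin> B" "insert g B = B0" using B0 by (auto simp: B_def)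
  have fin: "finite B" using B(1) finite_subset by blast
  define r where "r = card B"
  obtain b where b: "bij_betw b {..<r} B"
    using ex_bij_betw_nat_finite[OF fin] by (auto simp: r_def lessThan_atLeast0)
  have sumB: "(\<Sum>v\<in>B. h v) = (\<Sum>j<r. h (b j))" for h :: "real \<Rightarrow> real"
    using sum.reindex_bij_betw[OF b, of h] by simp
  have sumB0: "(\<Sum>v\<in>B0. h v) = h g + (\<Sum>j<r. h (b j))" for h :: "real \<Rightarrow> real"
    using fin B(2) by (simp add: B(3)[symmetric] sumB)
  have fin0: "finite B0" using fin B(3) by (metis finite_insert)
  have "\<exists>u. i \<in> {1..l} \<longrightarrow> a i = of_rat (u g) * g + (\<Sum>j<r. of_rat (u (b j)) * b j)" for i
  proof (cases "i \<in> {1..l}")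
    case True
    then have "a i \<in> rat_vs.span B0" using B0(4) by auto
    then obtain u where "a i = (\<Sum>v\<in>B0. rat_scale (u v) v)"
      unfolding rat_vs.span_finite[OF fin0] by auto
    then show ?thesis unfolding sumB0 rat_scale_def by blast
  qed auto
  then obtain u where u: "\<And>i. i \<in> {1..l} \<Longrightarrow> a i = of_rat (u i g) * g + (\<Sum>j<r. of_rat (u i (b j)) * b j)"
    by metis
  have "finite ((\<lambda>(i, v). u i v) ` ({1..l} \<times> B0))" using fin0 by simp
  then obtain D :: int where D: "D > 0" "\<And>x. x \<in> (\<lambda>(i, v). u i v) ` ({1..l} \<times> B0) \<Longrightarrow> of_int D * x \<in> \<int>"
    using common_denominator by blast
  have "\<exists>n::int. i \<in> {1..l} \<and> v \<in> B0 \<longrightarrow> of_int D * u i v = of_int n" for i v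
  proof (cases "i \<in> {1..l} \<and> v \<in> B0")
    case True
    then have "u i v \<in> (\<lambda>(i, v). u i v) ` ({1..l} \<times> B0)" by force
    then show ?thesis using D(2) by (metis Ints_cases)
  qed auto
  then obtain n :: "nat \<Rightarrow> real \<Rightarrow> int" where n: "\<And>i v. i \<in> {1..l} \<Longrightarrow> v \<in> B0 \<Longrightarrow> of_int D * u i v = of_int (n i v)"
    by metis
  have n': "of_int D * of_rat (u i v) = real_of_int (n i v)" if "i \<in> {1..l}" "v \<in> B0" for i v
    using arg_cong[OF n[OF that], of "of_rat :: rat \<Rightarrow> real"] by (simp add: of_rat_mult)
  have bB0: "b j \<in> B0" if "j < r" for j
    using b that B(3) by (auto simp: bij_betw_def)
  define \<theta> where "\<theta> = of_int D / g"
  have \<theta>: "\<theta> > 0" "g * \<theta> = of_int D" using D(1) g by (auto simp: \<theta>_def)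
  have \<theta>a: "\<theta> * a i = of_int (n i g) + (\<Sum>j<r. of_int (n i (b j)) * (b j / g))" if i: "i \<in> {1..l}" for i
  proof -
    have "\<theta> * a i = of_int D * of_rat (u i g) + (\<Sum>j<r. (of_int D * of_rat (u i (b j))) * (b j / g))"
      using g unfolding u[OF i] by (simp add: \<theta>_def algebra_simps add_divide_distrib sum_distrib_left sum_divide_distrib)
    also have "\<dots> = of_int (n i g) + (\<Sum>j<r. of_int (n i (b j)) * (b j / g))"
      using n'[OF i] B0(1) bB0 by simp
    finally show ?thesis .
  qed
  define Z where "Z k = (\<Sum>s<k. n (\<iota> s) g)" for k
  define C where "C k j = (\<Sum>s<k. n (\<iota> s) (b j))" for k j
  have \<theta>y: "\<theta> * y k = of_int (Z k) + (\<Sum>j<r. of_int (C k j) * (b j / g))" for k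
  proof -
    have "\<theta> * y k = (\<Sum>s<k. of_int (n (\<iota> s) g) + (\<Sum>j<r. of_int (n (\<iota> s) (b j)) * (b j / g)))"
      unfolding y sum_distrib_left by (intro sum.cong refl \<theta>a \<iota>)
    also have "\<dots> = of_int (Z k) + (\<Sum>j<r. of_int (C k j) * (b j / g))"
      unfolding sum.distrib sum.swap[of _ "{..<r}" "{..<k}"] by (simp add: Z_def C_def sum_distrib_right sum_divide_distrib)
    finally show ?thesis .
  qed
  have indep: "\<forall>j<r. m j = 0" if rel: "of_rat m0 = (\<Sum>j<r. of_rat (m j) * (b j / g))"
    for m0 and m :: "nat \<Rightarrow> rat"
  proof (intro allI impI)
    fix j assume j: "j < r"
    define w where "w v = (if v = g then - m0 else m (the_inv_into {..<r} b v))" for v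
    have wb: "w (b j) = m j" if "j < r" for j
      using that b B(2) by (auto simp: w_def bij_betw_def the_inv_into_f_f)
    have "(\<Sum>v\<in>B0. rat_scale (w v) v) = - of_rat m0 * g + (\<Sum>j<r. of_rat (m j) * b j)"
      unfolding sumB0 using wb by (simp add: rat_scale_def w_def of_rat_minus)
    also have "\<dots> = 0" using g unfolding rel by (simp add: sum_distrib_right)
    finally have "w (b j) = 0"
      using rat_vs.independentD[OF B0(3) fin0 subset_refl _ bB0[OF j], of w] by blast
    then show "m j = 0" using wb[OF j] by simp
  qed
  have "\<exists>j0<r. \<not> (\<exists>K. \<forall>k. \<bar>real_of_int (C k j0)\<bar> \<le> K)"
  proof (rule ccontr)
    assume "\<not> ?thesis"
    then obtain K where K: "\<And>j k. j < r \<Longrightarrow> \<bar>real_of_int (C k j)\<bar> \<le> K j" by metis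
    define K' where "K' = (\<Sum>j<r. \<lceil>\<bar>K j\<bar>\<rceil>)"
    have C: "C k j \<in> {-K'..K'}" if "j < r" for j k
    proof -
      have "\<bar>C k j\<bar> \<le> \<lceil>\<bar>K j\<bar>\<rceil>" using K[OF that, of k] by linarith
      also have "\<dots> \<le> K'" unfolding K'_def using that by (intro member_le_sum) auto
      finally show ?thesis by auto
    qed
    define F where "F k = map (C k) [0..<r]" for k
    have "range F \<subseteq> {xs. set xs \<subseteq> {-K'..K'} \<and> length xs = r}"
      using C by (auto simp: F_def)
    then have "finite (range F)"
      by (rule finite_subset) (simp add: finite_lists_length_eq)
    then have "\<not> inj F" using finite_imageD infinite_UNIV_nat by blast
    then obtain k k' where kk: "k < k'" "F k = F k'"
      unfolding inj_on_def by (metis UNIV_I linorder_neqE_nat)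
    then have Ceq: "C k j = C k' j" if "j < r" for j
      using that by (auto simp: F_def)
    define c where "c i = card {s \<in> {k..<k'}. \<iota> s = i}" for i
    have split: "y k' - y k = (\<Sum>s\<in>{k..<k'}. a (\<iota> s))"
      unfolding y using kk(1) by (simp add: sum_diff_nat_ivl lessThan_atLeast0)
    also have "\<dots> = (\<Sum>i\<in>{1..l}. \<Sum>s\<in>{s\<in>{k..<k'}. \<iota> s = i}. a (\<iota> s))"
      by (rule sum.group[symmetric]) (use \<iota> in auto)
    also have "\<dots> = (\<Sum>i\<in>{1..l}. real (c i) * a i)" by (simp add: c_def)
    finally have Y: "y k' - y k = (\<Sum>i\<in>{1..l}. real (c i) * a i)" .
    have pos: "y k' - y k > 0" unfolding split using kk(1) a \<iota> by (intro sum_pos) auto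
    define z where "z = Z k' - Z k"
    have "\<theta> * (y k' - y k) = of_int z"
      unfolding right_diff_distrib \<theta>y z_def using Ceq by simp
    then have z: "real_of_int z > 0" "of_int D * (y k' - y k) = of_int z * g"
      using pos \<theta>(1) g by (metis zero_less_mult_iff, simp add: \<theta>_def field_simps)
    define t :: "nat \<Rightarrow> rat" where "t i = of_int D * of_nat (c i) / of_int z" for i
    have "\<forall>i\<in>{1..l}. 0 \<le> t i" using D(1) z(1) by (simp add: t_def)
    moreover have "g = (\<Sum>i\<in>{1..l}. of_rat (t i) * a i)"
    proof -
      have "(\<Sum>i\<in>{1..l}. of_rat (t i) * a i) = (\<Sum>i\<in>{1..l}. of_int D / of_int z * (real (c i) * a i))"
        by (simp add: t_def of_rat_mult of_rat_divide mult.assoc)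
      also have "\<dots> = of_int D / of_int z * (y k' - y k)" by (simp only: Y sum_distrib_left)
      also have "\<dots> = g" using z by (simp add: field_simps)
      finally show ?thesis by simp
    qed
    ultimately show False using nocone by blast
  qed
  then obtain j0 where j0: "j0 < r" "\<not> (\<exists>K. \<forall>k. \<bar>real_of_int (C k j0)\<bar> \<le> K)" by blast
  define A where "A = (\<Sum>i\<in>{1..l}. \<Sum>j<r. \<bar>n i (b j)\<bar>)"
  have step: "\<bar>C (Suc k) j - C k j\<bar> \<le> A" if "j < r" for k j
  proof -
    have "\<bar>n (\<iota> k) (b j)\<bar> \<le> (\<Sum>j<r. \<bar>n (\<iota> k) (b j)\<bar>)" using that by (intro member_le_sum) auto
    also have "\<dots> \<le> A" unfolding A_def using \<iota> by (intro member_le_sum) (auto intro: sum_nonneg)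
    finally show ?thesis by (simp add: C_def)
  qed
  have "1 \<le> \<sigma> * (real r + 1)"
    by (rule slow_walk_exponent[OF \<theta> \<theta>y step indep j0 col])
  then show thesis
    using that[of B] B B0(3) by (simp add: r_def)
qed

text \<open>
For two letters with \<open>card B \<le> 1\<close> the first bound is already \<open>1/2\<close>, so the finer analysis is only needed
when \<open>g\<close> and the two steps are independent over the rationals.
\<close>

lemma multi_rotation_exponent:
  fixes a :: "nat \<Rightarrow> real" and \<iota> :: "nat \<Rightarrow> nat" and g :: real
  assumes a: "\<And>i. i \<in> {1..l} \<Longrightarrow> 0 < a i" and \<iota>: "\<And>k. \<iota> k \<in> {1..l}" and g: "g > 0"
    and nocone: "\<not> (\<exists>t :: nat \<Rightarrow> rat. (\<forall>i\<in>{1..l}. 0 \<le> t i) \<and> g = (\<Sum>i\<in>{1..l}. of_rat (t i) * a i))"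
    and y: "\<And>k. y k = (\<Sum>s<k. a (\<iota> s))"
    and T: "finite T" "a ` {1..l} \<subseteq> rat_vs.span T"
    and col: "colouring_exponent UNIV (\<lambda>\<delta> k k'. \<exists>n::int. \<bar>y k - y k' - of_int n * g\<bar> \<le> \<delta>) \<sigma>"
  shows "1 \<le> \<sigma> * (real (card T) + 1)" and "l = 2 \<Longrightarrow> 1 \<le> 2 * \<sigma>"
proof -
  obtain B where B: "B \<subseteq> a ` {1..l}" "g \<notin> B" "rat_vs.independent (insert g B)" "1 \<le> \<sigma> * (real (card B) + 1)"
    using multi_rotation_exponent_rank[OF a \<iota> g nocone y col] by blast
  have indB: "rat_vs.independent B" using B(3) rat_vs.independent_mono by blast
  have \<sigma>: "\<sigma> > 0"
  proof (rule ccontr)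
    assume "\<not> \<sigma> > 0"
    then have "\<sigma> * (real (card B) + 1) \<le> 0" by (intro mult_nonpos_nonneg) auto
    then show False using B(4) by linarith
  qed
  have mono: "1 \<le> \<sigma> * (real n + 1)" if "card B \<le> n" for n
  proof -
    have "\<sigma> * (real (card B) + 1) \<le> \<sigma> * (real n + 1)" using that \<sigma> by (intro mult_left_mono) auto
    then show ?thesis using B(4) by linarith
  qed
  have "card B \<le> card T"
    using rat_vs.independent_span_bound[OF T(1) indB] B(1) T(2) by blast
  then show "1 \<le> \<sigma> * (real (card T) + 1)" by (rule mono)
  assume l: "l = 2"
  have I: "{1..l} = {1, 2::nat}" using l by auto
  show "1 \<le> 2 * \<sigma>"
  proof (cases "card B \<le> 1")
    case True
    then show ?thesis using mono[of 1] by simp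
  next
    case False
    have sub: "B \<subseteq> {a 1, a 2}" using B(1) I by simp
    then have "card B \<le> card {a 1, a 2}" by (intro card_mono) auto
    also have "\<dots> \<le> 2" by (cases "a 1 = a 2") auto
    finally have "card B = card {a 1, a 2}" "a 1 \<noteq> a 2" using False card_mono[OF _ sub] by (cases "a 1 = a 2"; simp)+
    then have Beq: "B = {a 1, a 2}" using sub by (intro card_subset_eq) auto
    have ind: "u = 0 \<and> v = 0" if rel: "of_rat u * a 1 + of_rat v * (a 1 + (a 2 - a 1)) = of_rat w * g" for u v w
    proof -
      define c where "c x = (if x = g then - w else if x = a 1 then u else v)" for x
      have ne: "g \<noteq> a 1" "g \<noteq> a 2" "a 1 \<noteq> a 2" using B(2) Beq \<open>a 1 \<noteq> a 2\<close> by auto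
      then have "(\<Sum>x\<in>{g, a 1, a 2}. rat_scale (c x) x) = 0"
        using rel by (simp add: c_def rat_scale_def of_rat_minus)
      then have "c x = 0" if "x \<in> {g, a 1, a 2}" for x
        using rat_vs.independentD[OF B(3), of "{g, a 1, a 2}" c x] that Beq by auto
      from this[of "a 1"] this[of "a 2"] show ?thesis using ne by (simp add: c_def)
    qed
    define m where "m k = (\<Sum>s<k. if \<iota> s = 2 then 1 else 0 :: int)" for k
    have ym: "y k = real k * a 1 + of_int (m k) * (a 2 - a 1)" for k
    proof (induction k)
      case 0 show ?case by (simp add: y m_def)
    next
      case (Suc k)
      have "\<iota> k = 1 \<or> \<iota> k = 2" using \<iota>[of k] unfolding I by blast
      moreover have "y (Suc k) = y k + a (\<iota> k)" "m (Suc k) = m k + (if \<iota> k = 2 then 1 else 0)"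
        by (simp_all add: y m_def)
      ultimately show ?case unfolding Suc by (elim disjE) (simp_all add: algebra_simps)
    qed
    show ?thesis
    proof (cases "\<exists>J. \<forall>p k k'. (m (k + p) - m k) - (m (k' + p) - m k') \<le> J")
      case True
      then obtain J where J: "\<And>p k k'. (m (k + p) - m k) - (m (k' + p) - m k') \<le> J" by blast
      have "1 \<le> \<sigma> * 2"
        by (rule two_letter_exponent_bounded_discrepancy[OF g ind _ ym J col]) (auto simp: m_def)
      then show ?thesis by simp
    next
      case False
      show ?thesis
      proof (rule two_letter_exponent_unbounded_discrepancy[OF g _ _ ym _ col])
        show "(a 2 - a 1) / g \<notin> \<rat>"
        proof
          assume "(a 2 - a 1) / g \<in> \<rat>"
          then obtain w where "(a 2 - a 1) / g = of_rat w" by (auto elim!: Rats_cases)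
          then have "of_rat (- 1) * a 1 + of_rat 1 * (a 1 + (a 2 - a 1)) = of_rat w * g"
            using g by (simp add: field_simps of_rat_minus)
          then have "(- 1 :: rat) = 0 \<and> (1 :: rat) = 0" by (rule ind)
          then show False by simp
        qed
        show "m (Suc k) = m k \<or> m (Suc k) = m k + 1" for k by (simp add: m_def)
        show "\<exists>p k k'. J \<le> (m (k + p) - m k) - (m (k' + p) - m k')" for J
        proof -
          obtain p k k' where "\<not> (m (k + p) - m k) - (m (k' + p) - m k') \<le> J" using False by blast
          then show ?thesis by (intro exI[of _ p] exI[of _ k] exI[of _ k']) linarith
        qed
      qed
    qed
  qed
qed

section \<open>Separated iterated function systems\<close>

text \<open>
Only distances between points of the attractor matter, so the maps are scalings of a metric space and the
strong separation condition is recorded by a positive gap between first-level pieces.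
\<close>

locale separated_ifs =
  fixes l :: nat and \<phi> :: "nat \<Rightarrow> 'a::metric_space \<Rightarrow> 'a" and \<rho> :: "nat \<Rightarrow> real"
    and E :: "'a set" and gap :: real
  assumes ratio: "i \<in> {1..l} \<Longrightarrow> 0 < \<rho> i" "i \<in> {1..l} \<Longrightarrow> \<rho> i < 1"
    and scale: "i \<in> {1..l} \<Longrightarrow> dist (\<phi> i x) (\<phi> i y) = \<rho> i * dist x y"
    and nonempty: "E \<noteq> {}" and compact: "compact E" and invariant: "E = (\<Union>i\<in>{1..l}. \<phi> i ` E)"
    and gap_pos: "gap > 0"
    and gap: "\<lbrakk>i \<in> {1..l}; j \<in> {1..l}; i \<noteq> j; x \<in> E; y \<in> E\<rbrakk> \<Longrightarrow> gap \<le> dist (\<phi> i x) (\<phi> j y)"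
begin

text \<open>
Compositions of maps of the system, paired with their ratios, which are needed as separate data because
the map does not determine its ratio in a metric space with a single point.
\<close>

inductive_set cylinders :: "(('a \<Rightarrow> 'a) \<times> real) set" where
  base: "(id, 1) \<in> cylinders"
| step: "(h, r) \<in> cylinders \<Longrightarrow> i \<in> {1..l} \<Longrightarrow> (h \<circ> \<phi> i, r * \<rho> i) \<in> cylinders"

lemma cylinder_map:
  assumes "(h, r) \<in> cylinders"
  shows "0 < r" "dist (h x) (h y) = r * dist x y" "x \<in> E \<Longrightarrow> h x \<in> E"
proof -
  have "0 < r \<and> (\<forall>x y. dist (h x) (h y) = r * dist x y) \<and> (\<forall>x\<in>E. h x \<in> E)"
    using assms
  proof (induction rule: cylinders.induct)
    case (step h r i)
    moreover have "\<phi> i x \<in> E" if "x \<in> E" for x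
      using that step.hyps(2) invariant by blast
    ultimately show ?case using ratio scale by (auto simp: mult.assoc)
  qed auto
  then show "0 < r" "dist (h x) (h y) = r * dist x y" "x \<in> E \<Longrightarrow> h x \<in> E" by auto
qed

lemma first_level:
  assumes "x \<in> E"
  obtains i z where "i \<in> {1..l}" "z \<in> E" "x = \<phi> i z"
  using assms invariant by blast

lemma cylinder_separation:
  assumes h: "(h, r) \<in> cylinders" and ij: "i \<in> {1..l}" "j \<in> {1..l}" "x \<in> E" "y \<in> E"
    and close: "dist (h (\<phi> i x)) (h (\<phi> j y)) < gap * r"
  shows "i = j"
proof (rule ccontr)
  assume "i \<noteq> j"
  then have "gap \<le> dist (\<phi> i x) (\<phi> j y)" using gap ij by blast
  then show False
    using close cylinder_map(1,2)[OF h] by (simp add: mult.commute)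
qed

lemma nearby_point_in_cylinder:
  assumes "(h, r) \<in> cylinders" "u \<in> h ` E" "x \<in> E" "dist x u < gap * r"
  shows "x \<in> h ` E"
  using assms
proof (induction arbitrary: u rule: cylinders.induct)
  case (step h r i)
  obtain w where w: "w \<in> E" "u = h (\<phi> i w)" using step.prems by auto
  have r: "0 < r" "0 < \<rho> i" "\<rho> i < 1" using cylinder_map(1)[OF step.hyps(1)] ratio step.hyps(2) by auto
  have "gap * (r * \<rho> i) \<le> gap * (r * 1)" using r gap_pos by (intro mult_left_mono) auto
  then have d: "dist x u < gap * r" using step.prems(3) by simp
  have "u \<in> h ` E" using w step.hyps(2) invariant by blast
  then obtain z where z: "z \<in> E" "x = h z" using step.IH d step.prems(2) by blast
  obtain j v where v: "j \<in> {1..l}" "v \<in> E" "z = \<phi> j v" using first_level[OF z(1)] .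
  have "j = i" by (rule cylinder_separation[OF step.hyps(1) v(1) step.hyps(2) v(2) w(1)]) (use d z v w in simp)
  then show ?case using v z by auto
qed auto

text \<open>
As long as the gap inside the current cylinder exceeds \<open>R\<close>, the set lies in one of its children. The ratios
tend to zero, so this descent ends at a cylinder of size comparable to \<open>R\<close> or smaller.
\<close>

lemma small_set_in_cylinder:
  assumes V: "\<And>x y. x \<in> V \<Longrightarrow> y \<in> V \<Longrightarrow> dist x y \<le> R" and R: "R > 0"
  obtains h r where "(h, r) \<in> cylinders" "V \<inter> E \<subseteq> h ` E" "r * gap \<le> R"
proof -
  define m where "m = Max (\<rho> ` {1..l})"
  have ne: "{1..l} \<noteq> {}" using nonempty invariant by fastforce
  have m: "m < 1" "\<And>i. i \<in> {1..l} \<Longrightarrow> \<rho> i \<le> m"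
    using ne ratio(2) by (auto simp: m_def)
  have m0: "m \<ge> 0" using ne m(2) ratio(1) by (metis all_not_in_conv less_imp_le order_trans)
  have "\<exists>h r. (h, r) \<in> cylinders \<and> V \<inter> E \<subseteq> h ` E \<and> (r * gap \<le> R \<or> r \<le> m ^ n)" for n
  proof (induction n)
    case 0
    show ?case by (intro exI[of _ id] exI[of _ 1] conjI cylinders.base) auto
  next
    case (Suc n)
    then obtain h r where h: "(h, r) \<in> cylinders" "V \<inter> E \<subseteq> h ` E" "r * gap \<le> R \<or> r \<le> m ^ n" by blast
    show ?case
    proof (cases "r * gap \<le> R \<or> V \<inter> E = {}")
      case True
      show ?thesis
      proof (cases "r * gap \<le> R")
        case False
        with True have "V \<inter> E = {}" by blast
        obtain i where i: "i \<in> {1..l}" using ne by blast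
        have "r * \<rho> i \<le> m ^ n * m"
          using h(3) False m(2)[OF i] ratio(1)[OF i] cylinder_map(1)[OF h(1)] m0 by (intro mult_mono) auto
        then have "r * \<rho> i \<le> m ^ Suc n" by (simp add: mult.commute)
        then show ?thesis
          using cylinders.step[OF h(1) i] \<open>V \<inter> E = {}\<close> by blast
      qed (use h in blast)
    next
      case False
      then obtain x where x: "x \<in> V" "x \<in> E" by blast
      obtain z where z: "z \<in> E" "x = h z" using x h(2) by blast
      obtain i w where w: "i \<in> {1..l}" "w \<in> E" "z = \<phi> i w" using first_level[OF z(1)] .
      have "V \<inter> E \<subseteq> (h \<circ> \<phi> i) ` E"
      proof
        fix x' assume x': "x' \<in> V \<inter> E"
        obtain z' where z': "z' \<in> E" "x' = h z'" using x' h(2) by blast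
        obtain j w' where w': "j \<in> {1..l}" "w' \<in> E" "z' = \<phi> j w'" using first_level[OF z'(1)] .
        have "dist x' x \<le> R" using V x' x by blast
        also have "R < gap * r" using False by (simp add: mult.commute)
        finally have "j = i"
          using cylinder_separation[OF h(1) w'(1) w(1) w'(2) w(2)] z z' w w' by simp
        then show "x' \<in> (h \<circ> \<phi> i) ` E" using w' z' by auto
      qed
      moreover have "r * \<rho> i \<le> m ^ n * m"
        using h(3) False m(2)[OF w(1)] ratio(1)[OF w(1)] cylinder_map(1)[OF h(1)] m0 by (intro mult_mono) auto
      then have "r * \<rho> i \<le> m ^ Suc n" by (simp add: mult.commute)
      ultimately show ?thesis
        using cylinders.step[OF h(1) w(1)] by blast
    qed
  qed
  moreover obtain n where "m ^ n < R / gap"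
    using real_arch_pow_inv[of "R / gap" m] m(1) R gap_pos by auto
  ultimately obtain h r where "(h, r) \<in> cylinders" "V \<inter> E \<subseteq> h ` E" "r * gap \<le> R \<or> r \<le> R / gap"
    by (metis order_less_imp_le order_trans)
  then show thesis using that gap_pos by (auto simp: field_simps)
qed

lemma coding:
  assumes "u \<in> E"
  obtains \<iota> :: "nat \<Rightarrow> nat" and H where "\<And>k. \<iota> k \<in> {1..l}"
    "\<And>k. (H k, \<Prod>s<k. \<rho> (\<iota> s)) \<in> cylinders" "\<And>k. u \<in> H k ` E"
proof -
  have "\<forall>x. \<exists>i z. x \<in> E \<longrightarrow> i \<in> {1..l} \<and> z \<in> E \<and> x = \<phi> i z"
    using invariant by blast
  then obtain c t where ct: "\<And>x. x \<in> E \<Longrightarrow> c x \<in> {1..l} \<and> t x \<in> E \<and> x = \<phi> (c x) (t x)"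
    by metis
  define w where "w k = (t ^^ k) u" for k
  have w: "w k \<in> E" for k by (induction k) (use assms ct in \<open>auto simp: w_def\<close>)
  define \<iota> where "\<iota> k = c (w k)" for k
  have \<iota>: "\<iota> k \<in> {1..l}" for k using ct w by (simp add: \<iota>_def)
  define H where "H = rec_nat id (\<lambda>k h. h \<circ> \<phi> (\<iota> k))"
  have H: "H 0 = id" "H (Suc k) = H k \<circ> \<phi> (\<iota> k)" for k by (simp_all add: H_def)
  show thesis
  proof
    show "\<iota> k \<in> {1..l}" for k by (rule \<iota>)
    show "(H k, \<Prod>s<k. \<rho> (\<iota> s)) \<in> cylinders" for k
    proof (induction k)
      case 0 show ?case unfolding H lessThan_0 prod.empty by (rule cylinders.base)
    next
      case (Suc k)
      show ?case unfolding H prod.lessThan_Suc by (rule cylinders.step[OF Suc \<iota>])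
    qed
    show "u \<in> H k ` E" for k
    proof -
      have "H k (w k) = u"
      proof (induction k)
        case 0 show ?case by (simp add: H w_def)
      next
        case (Suc k)
        have "\<phi> (\<iota> k) (w (Suc k)) = w k" using ct[OF w[of k]] by (simp add: \<iota>_def w_def)
        then show ?case using Suc by (simp add: H)
      qed
      then show ?thesis using w[of k] by blast
    qed
  qed
qed

text \<open>
A cover witnessing \<open>H\<^sup>s(E) = 0\<close> is enlarged to open sets, reduced to a finite cover by compactness, and
each of its sets is replaced by a cylinder of at most comparable size. The constant lost is a power of the gap, which is
absorbed by starting from a cover with a small sum.
\<close>

lemma null_set_cylinder_cover:
  assumes s: "s \<ge> 0" and null: "hausdorff_measure s E = 0"
  obtains J :: "nat set" and h r where "s > 0" "finite J" "\<And>k. k \<in> J \<Longrightarrow> (h k, r k) \<in> cylinders"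
    "E \<subseteq> (\<Union>k\<in>J. h k ` E)" "(\<Sum>k\<in>J. r k powr s) < 1"
proof -
  have "hausdorff_premeasure s 1 E \<le> hausdorff_measure s E"
    unfolding hausdorff_measure_def by (intro SUP_upper) simp
  then have pre: "hausdorff_premeasure s 1 E = 0" using null by simp
  have cover: "\<exists>U :: nat \<Rightarrow> 'a set. E \<subseteq> (\<Union>k. U k) \<and> (\<forall>k. bounded (U k)) \<and> (\<Sum>k. diam_pow s (U k)) < ennreal \<eta>"
    if "\<eta> > 0" for \<eta>
  proof -
    have "hausdorff_premeasure s 1 E < ennreal \<eta>" using pre that by simp
    then show ?thesis unfolding hausdorff_premeasure_def INF_less_iff by blast
  qed
  \<comment> \<open>For \<open>s = 0\<close> every non-empty covering set contributes 1 to the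
    sum.\<close>
  have spos: "s > 0"
  proof (rule ccontr)
    assume "\<not> s > 0"
    with s have s0: "s = 0" by simp
    obtain U :: "nat \<Rightarrow> 'a set" where U: "E \<subseteq> (\<Union>k. U k)" "(\<Sum>k. diam_pow s (U k)) < ennreal 1"
      using cover[of 1] by auto
    obtain x k where "x \<in> E" "x \<in> U k" using U(1) nonempty by blast
    then have "diam_pow s (U k) = 1" by (auto simp: diam_pow_def s0)
    moreover have "(\<Sum>k\<in>{k}. diam_pow s (U k)) \<le> (\<Sum>k. diam_pow s (U k))"
      by (rule sum_le_suminf) auto
    ultimately show False using U(2) by simp
  qed
  define \<eta> where "\<eta> = gap powr s / 3"
  have \<eta>: "\<eta> > 0" using gap_pos by (simp add: \<eta>_def)
  obtain U :: "nat \<Rightarrow> 'a set" where U: "E \<subseteq> (\<Union>k. U k)" "\<And>k. bounded (U k)"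
    "(\<Sum>k. diam_pow s (U k)) < ennreal \<eta>"
    using cover[OF \<eta>] by blast
  define d where "d k = diameter (U k)" for k
  have d: "d k \<ge> 0" for k unfolding d_def by (rule diameter_ge_0[OF U(2)])
  have dp: "diam_pow s (U k) = ennreal (d k powr s)" for k
    using spos by (auto simp: diam_pow_def d_def)
  have sumd: "(\<Sum>k\<in>J. d k powr s) < \<eta>" if "finite J" for J
  proof -
    have "(\<Sum>k\<in>J. diam_pow s (U k)) \<le> (\<Sum>k. diam_pow s (U k))"
      by (rule sum_le_suminf) (use that in auto)
    then have "(\<Sum>k\<in>J. ennreal (d k powr s)) < ennreal \<eta>" using U(3) by (simp add: dp)
    then show ?thesis by (simp add: sum_ennreal ennreal_less_iff sum_nonneg)
  qed
  \<comment> \<open>The enlarged size \<open>R k\<close> is chosen such that its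
    \<open>s\<close>-th power exceeds that of the diameter by a summable amount; it is positive
    even for one-point sets.\<close>
  define R where "R k = (d k powr s + \<eta> * (1 / 2) ^ Suc k) powr (1 / s)" for k
  have Rs: "R k powr s = d k powr s + \<eta> * (1 / 2) ^ Suc k" for k
    using spos \<eta> by (simp add: R_def powr_powr add_nonneg_nonneg)
  have R: "R k > d k" for k
  proof -
    have "(d k powr s) powr (1 / s) < R k"
      unfolding R_def using spos \<eta> by (intro powr_less_mono2) auto
    then show ?thesis using d[of k] spos by (simp add: powr_powr)
  qed
  define V where "V k = (\<Union>x\<in>U k. ball x ((R k - d k) / 2))" for k
  have "E \<subseteq> (\<Union>k. V k)"
  proof
    fix x assume "x \<in> E"
    then obtain k where "x \<in> U k" using U(1) by blast
    then have "x \<in> V k" using R[of k] unfolding V_def by (intro UN_I[of x]) auto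
    then show "x \<in> (\<Union>k. V k)" by blast
  qed
  moreover have "open (V k)" for k unfolding V_def by blast
  ultimately obtain J where J: "finite J" "E \<subseteq> (\<Union>k\<in>J. V k)"
    by (auto intro: compactE_image[OF compact, of UNIV V])
  have Vd: "dist x y \<le> R k" if xy_V: "x \<in> V k" "y \<in> V k" for x y k
  proof -
    obtain x' y' where xy: "x' \<in> U k" "y' \<in> U k" "dist x' x < (R k - d k) / 2" "dist y' y < (R k - d k) / 2"
      using xy_V unfolding V_def UN_iff mem_ball by blast
    have "dist x' y' \<le> d k" unfolding d_def by (rule diameter_bounded_bound[OF U(2) xy(1,2)])
    moreover have "dist x y \<le> dist x' x + dist x' y' + dist y' y"
      by (metis add.commute dist_commute dist_triangle dist_triangle_le add_mono_thms_linordered_semiring(3) add_left_mono order_trans)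
    ultimately show ?thesis using xy(3,4) by (simp add: field_simps)
  qed
  have "\<exists>h r. (h, r) \<in> cylinders \<and> V k \<inter> E \<subseteq> h ` E \<and> r * gap \<le> R k" for k
    using small_set_in_cylinder[of "V k" "R k"] Vd R[of k] d[of k] by (metis le_less_trans)
  then obtain h r where hr: "\<And>k. (h k, r k) \<in> cylinders" "\<And>k. V k \<inter> E \<subseteq> h k ` E" "\<And>k. r k * gap \<le> R k"
    by metis
  have "(\<Sum>k\<in>J. r k powr s) * gap powr s = (\<Sum>k\<in>J. (r k * gap) powr s)"
    using cylinder_map(1)[OF hr(1)] gap_pos by (simp add: powr_mult sum_distrib_right less_imp_le)
  also have "\<dots> \<le> (\<Sum>k\<in>J. R k powr s)"
    using hr(3) cylinder_map(1)[OF hr(1)] gap_pos spos by (intro sum_mono powr_mono2) (auto intro!: mult_nonneg_nonneg less_imp_le)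
  also have "\<dots> = (\<Sum>k\<in>J. d k powr s) + \<eta> * (\<Sum>k\<in>J. (1 / 2) ^ Suc k)"
    unfolding Rs sum.distrib sum_distrib_left ..
  also have "\<dots> < \<eta> + \<eta> * 1"
  proof (rule add_less_le_mono[OF sumd[OF J(1)]])
    have "(\<Sum>k\<in>J. (1 / 2 :: real) ^ Suc k) \<le> (\<Sum>k. (1 / 2) ^ Suc k)"
      by (rule sum_le_suminf) (use J(1) sums_summable[OF power_half_series] in auto)
    also have "\<dots> = 1" using power_half_series by (rule sums_unique[symmetric])
    finally show "\<eta> * (\<Sum>k\<in>J. (1 / 2) ^ Suc k) \<le> \<eta> * 1" using \<eta> by (intro mult_left_mono) auto
  qed
  also have "\<dots> < 1 * gap powr s" using gap_pos by (simp add: \<eta>_def)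
  finally have "(\<Sum>k\<in>J. r k powr s) < 1" using gap_pos by simp
  moreover have "E \<subseteq> (\<Union>k\<in>J. h k ` E)" using J(2) hr(2) by blast
  ultimately show thesis using that[of J h r] spos J(1) hr(1) by blast
qed

text \<open>
The cylinders of the previous lemma form an iterated function system with the same attractor, whose
ratios satisfy \<open>\<Sum> r\<^sub>k\<^sup>s < 1\<close>. A cover of \<open>E\<close> at scale \<open>\<delta>\<close> is put together from images of covers at the
scales \<open>\<delta>/r\<^sub>k\<close>, and the bound \<open>C \<delta>\<^sup>-\<^sup>s\<close> on their size reproduces itself because of this inequality.
\<close>

lemma null_set_colouring_exponent:
  assumes "s \<ge> 0" "hausdorff_measure s E = 0"
  shows "colouring_exponent E (\<lambda>\<delta> x y. dist x y \<le> \<delta>) s"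
proof -
  obtain J :: "nat set" and h r where s: "s > 0" and J: "finite J" "\<And>k. k \<in> J \<Longrightarrow> (h k, r k) \<in> cylinders"
    "E \<subseteq> (\<Union>k\<in>J. h k ` E)" "(\<Sum>k\<in>J. r k powr s) < 1"
    using null_set_cylinder_cover[OF assms] by blast
  have Jne: "J \<noteq> {}" using J(3) nonempty by auto
  have r: "0 < r k" if "k \<in> J" for k using cylinder_map(1)[OF J(2)[OF that]] .
  have r1: "r k < 1" if "k \<in> J" for k
  proof -
    have "r k powr s \<le> (\<Sum>k\<in>J. r k powr s)" using that J(1) by (intro member_le_sum) auto
    then have "r k powr s < 1 powr s" using J(4) by simp
    then show ?thesis using powr_less_cancel2[OF s r[OF that]] by simp
  qed
  define c where "c = Min (r ` J)"
  define m where "m = Max (r ` J)"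
  have c: "0 < c" "c < 1" "\<And>k. k \<in> J \<Longrightarrow> c \<le> r k"
    using J(1) Jne r r1 by (auto simp: c_def Min_less_iff)
  have m: "0 < m" "m < 1" "\<And>k. k \<in> J \<Longrightarrow> r k \<le> m"
    using J(1) Jne r r1 by (auto simp: m_def Max_gr_iff)
  obtain D0 where D0: "\<forall>x\<in>E. \<forall>y\<in>E. dist x y \<le> D0"
    using compact_imp_bounded[OF compact] bounded_two_points by blast
  define D where "D = max 1 D0"
  have D: "D \<ge> 1" "\<forall>x\<in>E. \<forall>y\<in>E. dist x y \<le> D" using D0 unfolding D_def by (auto intro: max.coboundedI2)
  define C where "C = (D / c) powr s"
  have C: "C > 0" using D c by (simp add: C_def)
  define cover where "cover \<delta> \<U> \<longleftrightarrow> finite \<U> \<and> real (card \<U>) \<le> C * \<delta> powr (- s) \<and> E \<subseteq> \<Union>\<U> \<and>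
      (\<forall>U\<in>\<U>. \<forall>x\<in>U. \<forall>y\<in>U. dist x y \<le> \<delta>)" for \<delta> and \<U> :: "'a set set"
  have big: "cover \<delta> {E}" if "D \<le> \<delta>" "\<delta> \<le> D / c" for \<delta>
  proof -
    have "\<delta> powr s \<le> C" unfolding C_def using that D s by (intro powr_mono2) auto
    then have "1 \<le> C * \<delta> powr (- s)" using that D by (simp add: powr_minus field_simps)
    then show ?thesis using D(2) that(1) by (auto simp: cover_def intro: order_trans)
  qed
  have "\<exists>\<U>. cover \<delta> \<U>" if "D * m ^ n \<le> \<delta>" "\<delta> \<le> D / c" for n \<delta>
    using that
  proof (induction n arbitrary: \<delta>)
    case 0
    then show ?case using big[of \<delta>] by auto
  next
    case (Suc n)
    show ?case
    proof (cases "D \<le> \<delta>")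
      case True
      then show ?thesis using big Suc.prems by blast
    next
      case False
      have \<delta>: "\<delta> > 0" using Suc.prems(1) D(1) m(1) by (smt (verit) mult_pos_pos zero_less_power)
      have "\<exists>\<U>. cover (\<delta> / r k) \<U>" if k: "k \<in> J" for k
      proof (rule Suc.IH)
        have "D * m ^ n * r k \<le> D * m ^ n * m" using m D k by (intro mult_left_mono) auto
        also have "\<dots> \<le> \<delta>" using Suc.prems(1) by (simp add: mult_ac)
        finally show "D * m ^ n \<le> \<delta> / r k" using r[OF k] by (simp add: pos_le_divide_eq)
        show "\<delta> / r k \<le> D / c" using False D \<delta> c(1) c(3)[OF k] by (intro frac_le) auto
      qed
      then obtain W where W: "\<And>k. k \<in> J \<Longrightarrow> cover (\<delta> / r k) (W k)" by metis
      define \<U> where "\<U> = (\<Union>k\<in>J. (`) (h k) ` W k)"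
      have "finite \<U>" using J(1) W by (auto simp: \<U>_def cover_def)
      moreover have "real (card \<U>) \<le> C * \<delta> powr (- s)"
      proof -
        have "card \<U> \<le> (\<Sum>k\<in>J. card ((`) (h k) ` W k))" unfolding \<U>_def by (rule card_UN_le[OF J(1)])
        also have "\<dots> \<le> (\<Sum>k\<in>J. card (W k))" using W by (intro sum_mono card_image_le) (auto simp: cover_def)
        finally have "real (card \<U>) \<le> (\<Sum>k\<in>J. real (card (W k)))" by (metis of_nat_le_iff of_nat_sum)
        also have "\<dots> \<le> (\<Sum>k\<in>J. C * (\<delta> / r k) powr (- s))" using W by (intro sum_mono) (auto simp: cover_def)
        also have "\<dots> = (\<Sum>k\<in>J. C * \<delta> powr (- s) * r k powr s)"
          using r \<delta> by (intro sum.cong refl) (simp add: powr_divide powr_minus field_simps less_imp_le)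
        also have "\<dots> = C * \<delta> powr (- s) * (\<Sum>k\<in>J. r k powr s)" by (simp add: sum_distrib_left)
        also have "\<dots> \<le> C * \<delta> powr (- s) * 1" using J(4) C by (intro mult_left_mono) auto
        finally show ?thesis by simp
      qed
      moreover have "E \<subseteq> \<Union>\<U>"
      proof
        fix x assume "x \<in> E"
        then obtain k z where kz: "k \<in> J" "z \<in> E" "x = h k z" using J(3) by blast
        then obtain U where "U \<in> W k" "z \<in> U" using W[OF kz(1)] by (auto simp: cover_def)
        then show "x \<in> \<Union>\<U>" using kz unfolding \<U>_def by blast
      qed
      moreover have "dist x y \<le> \<delta>" if U: "U \<in> \<U>" "x \<in> U" "y \<in> U" for U x y
      proof -
        obtain k U' x' y' where k: "k \<in> J" "U' \<in> W k" "x' \<in> U'" "y' \<in> U'" "x = h k x'" "y = h k y'"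
          using U unfolding \<U>_def by blast
        then have "dist x' y' \<le> \<delta> / r k" using W[OF k(1)] by (auto simp: cover_def)
        then show ?thesis
          using cylinder_map(2)[OF J(2)[OF k(1)]] k r[OF k(1)] by (simp add: field_simps)
      qed
      ultimately show ?thesis unfolding cover_def by blast
    qed
  qed
  note cover_ex = this
  show ?thesis
    unfolding colouring_exponent_def
  proof (intro exI[of _ C] conjI allI impI)
    show "C > 0" by (rule C)
    fix \<delta> :: real assume \<delta>: "0 < \<delta> \<and> \<delta> \<le> 1"
    obtain n where "m ^ n < \<delta> / D" using real_arch_pow_inv[of "\<delta> / D" m] m \<delta> D by auto
    then have "D * m ^ n \<le> \<delta>" using D by (simp add: field_simps)
    moreover have "\<delta> \<le> D / c" using \<delta> D c by (simp add: le_divide_eq) (smt (verit) mult_le_one)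
    ultimately obtain \<U> where \<U>: "cover \<delta> \<U>" using cover_ex by blast
    obtain f where f: "bij_betw f {..<card \<U>} \<U>"
      using ex_bij_betw_nat_finite[of \<U>] \<U> by (auto simp: cover_def lessThan_atLeast0)
    have "\<exists>i. x \<in> E \<longrightarrow> i < card \<U> \<and> x \<in> f i" for x
    proof (cases "x \<in> E")
      case True
      then obtain U where "U \<in> \<U>" "x \<in> U" using \<U> unfolding cover_def by blast
      moreover have "U \<in> f ` {..<card \<U>}" using bij_betw_imp_surj_on[OF f] \<open>U \<in> \<U>\<close> by simp
      ultimately show ?thesis by auto
    qed auto
    then obtain col where col: "\<And>x. x \<in> E \<Longrightarrow> col x < card \<U> \<and> x \<in> f (col x)" by metis
    have "dist x y \<le> \<delta>" if "x \<in> E" "y \<in> E" "col x = col y" for x y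
    proof -
      have "f (col x) \<in> \<U>" using col[OF that(1)] f by (auto simp: bij_betw_def)
      then show ?thesis using col[OF that(1)] col[OF that(2)] that(3) \<U> unfolding cover_def by auto
    qed
    then show "\<exists>col N. (\<forall>x\<in>E. col x < N) \<and> real N \<le> C * \<delta> powr - s \<and>
        (\<forall>x\<in>E. \<forall>y\<in>E. col x = col y \<longrightarrow> dist x y \<le> \<delta>)"
      using col \<U> unfolding cover_def by blast
  qed
qed

end

section \<open>Orbits of isometries and sequences in the attractor\<close>

lemma orthogonal_transformation_funpow:
  fixes T :: "'v::real_inner \<Rightarrow> 'v"
  shows "orthogonal_transformation T \<Longrightarrow> orthogonal_transformation (T ^^ n)"
proof (induction n)
  case 0
  have "T ^^ 0 = (\<lambda>x. x)" by (rule ext) simp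
  then show ?case by (simp only: orthogonal_transformation_def linear_ident simp_thms)
next
  case (Suc n)
  then show ?case using orthogonal_transformation_compose[of T "T ^^ n"] by (simp only: funpow.simps)
qed

text \<open>
Choose \<open>q\<close> such that \<open>T\<^sup>q\<close> has a fixed space of maximal dimension; then all powers of \<open>T\<^sup>q\<close> have the same
fixed space. The orthogonal complement of the fixed space of an isometry \<open>S\<close> is the range of \<open>S - id\<close>,
which gives the second summand for every \<open>p\<close>.
\<close>

lemma orthogonal_transformation_periodic_coboundary:
  fixes T :: "'v::euclidean_space \<Rightarrow> 'v"
  assumes T: "orthogonal_transformation T"
  obtains q x1 x2 where "q \<ge> 1" "x = x1 + x2" "(T ^^ q) x1 = x1"
    "\<And>p. p \<ge> 1 \<Longrightarrow> \<exists>y. x2 = (T ^^ (q * p)) y - y"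
proof -
  have orth: "orthogonal_transformation (T ^^ n)" for n
    using T by (rule orthogonal_transformation_funpow)
  then have lin: "linear (T ^^ n)" for n by (rule orthogonal_transformation_linear)
  define Fix where "Fix n = {x. (T ^^ n) x = x}" for n
  have subF: "subspace (Fix n)" for n
    using lin[of n] by (auto simp: subspace_def Fix_def linear_0 linear_add linear_cmul)
  obtain q where q: "q \<ge> 1" "\<And>n. n \<ge> 1 \<Longrightarrow> dim (Fix n) \<le> dim (Fix q)"
    using ex_has_greatest_nat[of "\<lambda>n. n \<ge> 1" 1 "\<lambda>n. dim (Fix n)" "DIM('v) + 1"] dim_subset_UNIV
    by (auto simp: less_Suc_eq_le)
  have Fix_eq: "Fix (q * p) = Fix q" if "p \<ge> 1" for p
  proof -
    have "(T ^^ (q * p)) x = x" if "(T ^^ q) x = x" for x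
    proof (induction p)
      case (Suc p)
      then show ?case using that by (simp add: funpow_add)
    qed simp
    then have "Fix q \<subseteq> Fix (q * p)" by (auto simp: Fix_def)
    moreover have "dim (Fix (q * p)) \<le> dim (Fix q)" using q that by simp
    ultimately show ?thesis using subspace_dim_equal[OF subF subF] by metis
  qed
  obtain x1 x2 where x: "x1 \<in> span (Fix q)" "\<And>w. w \<in> span (Fix q) \<Longrightarrow> orthogonal x2 w" "x = x1 + x2"
    using orthogonal_subspace_decomp_exists[of "Fix q" x] by metis
  have sp: "span (Fix q) = Fix q" using subF span_eq_iff by blast
  have "\<exists>y. x2 = (T ^^ (q * p)) y - y" if p: "p \<ge> 1" for p
  proof -
    define B where "B = T ^^ (q * p)"
    have B: "linear B" "\<And>v w. B v \<bullet> B w = v \<bullet> w"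
      using lin orth by (auto simp: B_def orthogonal_transformation_def)
    define Rg where "Rg = range (\<lambda>y. B y - y)"
    have "linear (\<lambda>y. B y - y)" using B(1) by (intro linear_compose_sub linear_ident)
    then have "subspace Rg" unfolding Rg_def using linear_subspace_image subspace_UNIV by blast
    then have spR: "span Rg = Rg" using span_eq_iff by blast
    obtain y1 y2 where y: "y1 \<in> span Rg" "\<And>w. w \<in> span Rg \<Longrightarrow> orthogonal y2 w" "x2 = y1 + y2"
      using orthogonal_subspace_decomp_exists[of Rg x2] by metis
    have "B y2 - y2 \<in> span Rg" unfolding spR by (simp add: Rg_def)
    then have "y2 \<bullet> (B y2 - y2) = 0" using y(2) by (simp add: orthogonal_def)
    then have "(B y2 - y2) \<bullet> (B y2 - y2) = 0"
      using B(2)[of y2 y2] by (simp add: inner_diff_left inner_diff_right inner_commute)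
    then have "y2 \<in> Fix (q * p)" by (simp add: Fix_def B_def)
    then have "x2 \<bullet> y2 = 0" using x(2) Fix_eq[OF p] sp by (auto simp: orthogonal_def)
    moreover have "y1 \<bullet> y2 = 0" using y(1,2) by (auto simp: orthogonal_def inner_commute)
    ultimately have "y2 = 0" using y(3) by (simp add: inner_add_left)
    then have "x2 \<in> Rg" using y(1,3) spR by simp
    then show ?thesis by (auto simp: Rg_def B_def)
  qed
  moreover have "(T ^^ q) x1 = x1" using x(1) unfolding sp by (simp add: Fix_def)
  ultimately show thesis using that[OF q(1) x(3)] by blast
qed

lemma orthogonal_transformation_recurrent:
  fixes T :: "'v::euclidean_space \<Rightarrow> 'v"
  assumes T: "orthogonal_transformation T" and "\<epsilon> > 0"
  obtains p where "p \<ge> 1" "norm ((T ^^ p) x - x) < \<epsilon>"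
proof -
  have orth: "orthogonal_transformation (T ^^ n)" for n
    using T by (rule orthogonal_transformation_funpow)
  have "(T ^^ n) x \<in> cball 0 (norm x)" for n
    using orthogonal_transformation_norm[OF orth] by simp
  then obtain L r where r: "strict_mono (r :: nat \<Rightarrow> nat)" "((\<lambda>n. (T ^^ n) x) \<circ> r) \<longlonglongrightarrow> L"
    using compact_cball[of 0 "norm x"] unfolding compact_def by meson
  then obtain M where M: "\<forall>m\<ge>M. \<forall>n\<ge>M. norm ((T ^^ r m) x - (T ^^ r n) x) < \<epsilon>"
    using CauchyD[OF LIMSEQ_imp_Cauchy[OF r(2)] assms(2)] by auto
  define p where "p = r (Suc M) - r M"
  have lt: "r M < r (Suc M)" using r(1) by (simp add: strict_mono_def)
  then have p: "p \<ge> 1" "r (Suc M) = r M + p" by (auto simp: p_def)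
  have "(T ^^ r (Suc M)) x - (T ^^ r M) x = (T ^^ r M) ((T ^^ p) x - x)"
    using linear_diff[OF orthogonal_transformation_linear[OF orth]] by (simp add: p(2) funpow_add)
  then have "norm ((T ^^ p) x - x) = norm ((T ^^ r (Suc M)) x - (T ^^ r M) x)"
    using orthogonal_transformation_norm[OF orth] by simp
  also have "\<dots> < \<epsilon>" using M by simp
  finally show thesis using that p(1) by blast
qed

text \<open>
The periodic part of \<open>x\<close> contributes the constant \<open>C\<close>, and along each arithmetic progression the other
part contributes a telescoping sum. Thus the sequence has bounded deviation from \<open>C\<close> along all progressions,
and it is almost periodic.
\<close>

lemma orbit_functional_averages:
  fixes T :: "'v::euclidean_space \<Rightarrow> 'v" and f :: "'v \<Rightarrow> real"
  assumes T: "orthogonal_transformation T" and f: "linear f"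
  obtains q C where "q \<ge> 1"
    "\<And>\<epsilon>. \<epsilon> > 0 \<Longrightarrow> \<exists>p\<ge>1. \<forall>n. \<bar>f ((T ^^ (q * (n + p))) x) - f ((T ^^ (q * n)) x)\<bar> \<le> \<epsilon>"
    "\<And>p i. p \<ge> 1 \<Longrightarrow> \<exists>B. \<forall>K. \<bar>\<Sum>k<K. f ((T ^^ (q * (i + p * k))) x) - C\<bar> \<le> B"
proof -
  have orth: "orthogonal_transformation (T ^^ n)" for n
    using T by (rule orthogonal_transformation_funpow)
  then have lin: "linear (T ^^ n)" for n by (rule orthogonal_transformation_linear)
  have nrm: "norm ((T ^^ n) v) = norm v" for n v using orthogonal_transformation_norm[OF orth] .
  obtain A where A: "A > 0" "\<And>v. \<bar>f v\<bar> \<le> A * norm v"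
    using linear_bounded_pos[OF f] by auto
  obtain q x1 x2 where q: "q \<ge> 1" "x = x1 + x2" "(T ^^ q) x1 = x1"
    and cob: "\<And>p. p \<ge> 1 \<Longrightarrow> \<exists>y. x2 = (T ^^ (q * p)) y - y"
    using orthogonal_transformation_periodic_coboundary[OF T] by blast
  have x1: "(T ^^ (q * n)) x1 = x1" for n
  proof (induction n)
    case (Suc n)
    then show ?case using q(3) by (simp add: funpow_add)
  qed simp
  show thesis
  proof
    show "q \<ge> 1" by (rule q(1))
    fix \<epsilon> :: real assume \<epsilon>: "\<epsilon> > 0"
    obtain p where p: "p \<ge> 1" "norm (((T ^^ q) ^^ p) x - x) < \<epsilon> / A"
      using orthogonal_transformation_recurrent[OF orth, of "\<epsilon> / A" q x] \<epsilon> A(1) by auto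
    have "\<bar>f ((T ^^ (q * (n + p))) x) - f ((T ^^ (q * n)) x)\<bar> \<le> \<epsilon>" for n
    proof -
      have "f ((T ^^ (q * (n + p))) x) - f ((T ^^ (q * n)) x) = f ((T ^^ (q * n)) (((T ^^ q) ^^ p) x - x))"
        using linear_diff[OF lin] linear_diff[OF f]
        by (simp add: add_mult_distrib2 funpow_add funpow_mult mult.commute)
      then have "\<bar>f ((T ^^ (q * (n + p))) x) - f ((T ^^ (q * n)) x)\<bar> \<le> A * norm (((T ^^ q) ^^ p) x - x)"
        using A(2) nrm by metis
      also have "\<dots> \<le> A * (\<epsilon> / A)" using p(2) A(1) by (intro mult_left_mono) auto
      finally show ?thesis using A(1) by simp
    qed
    then show "\<exists>p\<ge>1. \<forall>n. \<bar>f ((T ^^ (q * (n + p))) x) - f ((T ^^ (q * n)) x)\<bar> \<le> \<epsilon>"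
      using p(1) by blast
  next
    fix p i :: nat assume "p \<ge> 1"
    then obtain y where y: "x2 = (T ^^ (q * p)) y - y" using cob by blast
    define z where "z k = (T ^^ (q * (i + p * k))) y" for k
    have "f ((T ^^ (q * (i + p * k))) x) - f x1 = f (z (Suc k)) - f (z k)" for k
    proof -
      have exp: "q * (i + p * Suc k) = q * (i + p * k) + q * p" by (simp add: algebra_simps)
      have "(T ^^ (q * (i + p * k))) x2 = z (Suc k) - z k"
        unfolding y linear_diff[OF lin] z_def exp by (simp add: funpow_add)
      then have "(T ^^ (q * (i + p * k))) x = x1 + (z (Suc k) - z k)"
        unfolding q(2) linear_add[OF lin] x1 by simp
      then show ?thesis using linear_add[OF f] linear_diff[OF f] by simp
    qed
    then have tele: "(\<Sum>k<K. f ((T ^^ (q * (i + p * k))) x) - f x1) = f (z K) - f (z 0)" for K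
      using sum_lessThan_telescope[of "\<lambda>k. f (z k)" K] by simp
    have bound: "\<bar>f (z k)\<bar> \<le> A * norm y" for k using A(2)[of "z k"] by (simp add: z_def nrm)
    have "\<bar>\<Sum>k<K. f ((T ^^ (q * (i + p * k))) x) - f x1\<bar> \<le> 2 * (A * norm y)" for K
      unfolding tele using bound[of K] bound[of 0] by linarith
    then show "\<exists>B. \<forall>K. \<bar>\<Sum>k<K. f ((T ^^ (q * (i + p * k))) x) - f x1\<bar> \<le> B" by blast
  qed
qed

lemma abs_ln_diff_le:
  fixes a b c :: real
  assumes "0 < c" "c \<le> a" "c \<le> b"
  shows "\<bar>ln a - ln b\<bar> \<le> \<bar>a - b\<bar> / c"
proof -
  have aux: "ln x - ln y \<le> \<bar>x - y\<bar> / c" if "c \<le> x" "c \<le> y" for x y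
  proof -
    have "ln x - ln y = ln (x / y)" using assms that by (simp add: ln_div)
    also have "\<dots> \<le> x / y - 1" using assms that by (intro ln_le_minus_one) auto
    also have "\<dots> = (x - y) / y" using assms that by (simp add: diff_divide_distrib)
    also have "\<dots> \<le> \<bar>x - y\<bar> / c" using assms that by (intro frac_le) auto
    finally show ?thesis .
  qed
  show ?thesis using aux[of a b] aux[of b a] assms by (simp add: abs_minus_commute abs_le_iff)
qed

text \<open>
Suppose that \<open>W N > W 0\<close>. Along any progression of difference \<open>p\<close> the quantity \<open>h n = ln (W (n + N)) - ln (W n)\<close>
starts at \<open>h 0 > 0\<close> and cannot stay above \<open>h 0 / 2\<close>, since then the averages of \<open>W (n + N)\<close> and of \<open>W n\<close> along
the progression would differ. If \<open>p\<close> is an almost period, then \<open>h\<close> moves in small steps along the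
progression and so passes close to every point between these two values. The bound \<open>h 0 / 2\<close> is the same for
all \<open>p\<close>, so one interval serves all precisions.
\<close>

lemma log_ratio_dense_in_interval:
  fixes W :: "nat \<Rightarrow> real"
  assumes c: "c > 0" "\<And>n. c \<le> W n"
    and rec: "\<And>\<epsilon>. \<epsilon> > 0 \<Longrightarrow> \<exists>p\<ge>1. \<forall>n. \<bar>W (n + p) - W n\<bar> \<le> \<epsilon>"
    and avg: "\<And>p i. p \<ge> 1 \<Longrightarrow> \<exists>B. \<forall>K. \<bar>\<Sum>k<K. W (i + p * k) - C\<bar> \<le> B"
    and N: "W N \<noteq> W 0"
  obtains \<alpha> \<beta> where "\<alpha> < \<beta>"
    "\<And>t \<epsilon>. \<alpha> \<le> t \<Longrightarrow> t \<le> \<beta> \<Longrightarrow> \<epsilon> > 0 \<Longrightarrow> \<exists>n. \<bar>ln (W (n + N)) - ln (W n) - t\<bar> \<le> \<epsilon>"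
proof -
  have pos: "W n > 0" for n using c less_le_trans by blast
  have ln_diff: "ln a - ln b \<le> (a - b) / b" if "a > 0" "b > 0" for a b :: real
    using ln_add_one_self_le_self2[of "a / b - 1"] that by (simp add: ln_div diff_divide_distrib)
  define \<sigma> :: real where "\<sigma> = (if W N > W 0 then 1 else - 1)"
  define h where "h n = \<sigma> * (ln (W (n + N)) - ln (W n))" for n
  have h0: "h 0 > 0" using N pos[of N] pos[of 0] by (simp add: h_def \<sigma>_def)
  have low: "\<exists>k. h (p * k) < h 0 / 2" if p: "p \<ge> 1" for p
  proof (rule ccontr)
    assume "\<not> ?thesis"
    then have ge: "h 0 / 2 \<le> h (p * k)" for k by (meson not_le)
    obtain B1 where B1: "\<And>K. \<bar>\<Sum>k<K. W (N + p * k) - C\<bar> \<le> B1" using avg[OF p, of N] by blast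
    obtain B2 where B2: "\<And>K. \<bar>\<Sum>k<K. W (0 + p * k) - C\<bar> \<le> B2" using avg[OF p, of 0] by blast
    have gain: "c * (h 0 / 2) \<le> \<sigma> * (W (N + p * k) - W (p * k))" for k
    proof -
      have step: "c * (h 0 / 2) \<le> a - b" if "h 0 / 2 \<le> ln a - ln b" "c \<le> b" "0 < a" for a b :: real
      proof -
        have b: "b > 0" using that(2) c(1) by simp
        have "h 0 / 2 \<le> (a - b) / b" using ln_diff[OF that(3) b] that(1) by (rule order_trans[rotated])
        then have "b * (h 0 / 2) \<le> a - b" using b by (simp add: field_simps)
        moreover have "c * (h 0 / 2) \<le> b * (h 0 / 2)" using that(2) h0 by (intro mult_right_mono) auto
        ultimately show ?thesis by linarith
      qed
      show ?thesis
        using step[of "W (N + p * k)" "W (p * k)"] step[of "W (p * k)" "W (N + p * k)"]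
          ge[of k] c(2) pos by (auto simp: h_def \<sigma>_def add.commute split: if_splits)
    qed
    have "real K * (c * (h 0 / 2)) \<le> B1 + B2" for K
    proof -
      have "real K * (c * (h 0 / 2)) \<le> (\<Sum>k<K. \<sigma> * (W (N + p * k) - W (p * k)))"
        using sum_mono[of "{..<K}" "\<lambda>_. c * (h 0 / 2)", OF gain] by simp
      also have "\<dots> = \<sigma> * ((\<Sum>k<K. W (N + p * k) - C) - (\<Sum>k<K. W (0 + p * k) - C))"
        by (simp add: sum_distrib_left sum_subtractf[symmetric])
      also have "\<dots> \<le> B1 + B2" using B1[of K] B2[of K] by (auto simp: \<sigma>_def)
      finally show ?thesis .
    qed
    then show False
      using reals_Archimedean3[of "c * (h 0 / 2)"] c(1) h0 by (meson mult_pos_pos half_gt_zero not_le)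
  qed
  have hit: "\<exists>n. \<bar>h n - t\<bar> \<le> \<epsilon>" if t: "h 0 / 2 \<le> t" "t \<le> h 0" and \<epsilon>: "\<epsilon> > 0" for t \<epsilon>
  proof -
    obtain p where p: "p \<ge> 1" "\<And>n. \<bar>W (n + p) - W n\<bar> \<le> c * (\<epsilon> / 2)"
      using rec[of "c * (\<epsilon> / 2)"] c(1) \<epsilon> by auto
    have lnW: "\<bar>ln (W (n + p)) - ln (W n)\<bar> \<le> \<epsilon> / 2" for n
    proof -
      have "\<bar>ln (W (n + p)) - ln (W n)\<bar> \<le> \<bar>W (n + p) - W n\<bar> / c"
        by (rule abs_ln_diff_le[OF c(1) c(2) c(2)])
      also have "\<dots> \<le> \<epsilon> / 2" using p(2)[of n] c(1) by (simp add: divide_le_eq mult.commute)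
      finally show ?thesis .
    qed
    define H where "H k = - h (p * k)" for k
    have step: "H (Suc k) \<le> H k + \<epsilon>" for k
    proof -
      have "\<bar>h (p * k + p) - h (p * k)\<bar> \<le> \<epsilon>"
      proof -
        have eq: "p * k + N + p = p * k + p + N" by simp
        have "h (p * k + p) - h (p * k)
            = \<sigma> * ((ln (W (p * k + p + N)) - ln (W (p * k + N))) - (ln (W (p * k + p)) - ln (W (p * k))))"
          by (simp add: h_def algebra_simps)
        then have "\<bar>h (p * k + p) - h (p * k)\<bar>
            = \<bar>(ln (W (p * k + p + N)) - ln (W (p * k + N))) - (ln (W (p * k + p)) - ln (W (p * k)))\<bar>"
          by (simp add: abs_mult \<sigma>_def)
        then show ?thesis
          using lnW[of "p * k"] lnW[of "p * k + N", unfolded eq] by linarith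
      qed
      then show ?thesis by (simp add: H_def add.commute)
    qed
    obtain K where "h (p * K) < h 0 / 2" using low[OF p(1)] by blast
    then have "- t \<le> H K" using t by (simp add: H_def)
    moreover have "H 0 \<le> - t" using t by (simp add: H_def)
    ultimately obtain k where "- t \<le> H k" "H k \<le> - t + \<epsilon>"
      using discrete_intermediate_value[of H "- t" K \<epsilon>] step \<epsilon> by (metis less_imp_le)
    then show ?thesis by (intro exI[of _ "p * k"]) (auto simp: H_def)
  qed
  show thesis
  proof (cases "W N > W 0")
    case True
    show ?thesis
      by (rule that[of "h 0 / 2" "h 0"]) (use hit h0 True in \<open>auto simp: h_def \<sigma>_def\<close>)
  next
    case False
    show ?thesis
    proof (rule that[of "- h 0" "- (h 0 / 2)"])
      show "- h 0 < - (h 0 / 2)" using h0 by simp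
      fix t \<epsilon> :: real assume "- h 0 \<le> t" "t \<le> - (h 0 / 2)" "\<epsilon> > 0"
      then obtain n where "\<bar>h n - (- t)\<bar> \<le> \<epsilon>" using hit[of "- t" \<epsilon>] by auto
      then have "\<bar>ln (W (n + N)) - ln (W n) - t\<bar> \<le> \<epsilon>"
        using False by (simp add: h_def \<sigma>_def abs_le_iff)
      then show "\<exists>n. \<bar>ln (W (n + N)) - ln (W n) - t\<bar> \<le> \<epsilon>" by blast
    qed
  qed
qed

lemma abs_ln_dist_diff_le:
  fixes z w z' w' :: "'a::metric_space"
  assumes "0 < c" "c \<le> dist z w" "c \<le> dist z' w'" "dist z z' \<le> \<delta>" "dist w w' \<le> \<delta>"
  shows "\<bar>ln (dist z w) - ln (dist z' w')\<bar> \<le> 2 * \<delta> / c"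
proof -
  have "\<bar>dist z w - dist z' w'\<bar> \<le> 2 * \<delta>"
    using assms(4,5) dist_triangle[of z w z'] dist_triangle[of z' w w'] dist_triangle[of z' w' z] dist_triangle[of z w' w]
    by (simp add: dist_commute abs_le_iff)
  then have "\<bar>dist z w - dist z' w'\<bar> / c \<le> 2 * \<delta> / c" using assms(1) by (intro divide_right_mono) auto
  then show ?thesis using abs_ln_diff_le[OF assms(1-3)] by linarith
qed

context separated_ifs
begin

text \<open>
One cylinder contains \<open>u\<close>, \<open>x n\<close> and \<open>x (n + N)\<close>, so its ratio cancels from the quotient of the two
distances. The quotient is determined by the three preimages in \<open>E\<close>.
\<close>

lemma oscillation_exponent:
  fixes x :: "nat \<Rightarrow> 'a"
  assumes col: "colouring_exponent E (\<lambda>\<delta> x y. dist x y \<le> \<delta>) s"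
    and u: "u \<in> E" and x: "\<And>n. x n \<in> E"
    and c: "c > 0" "\<And>n. 0 < dist (x n) u" "\<And>n. c * (dist (x n) u + dist (x (n + N)) u) \<le> dist (x n) u"
      "\<And>n. c * (dist (x n) u + dist (x (n + N)) u) \<le> dist (x (n + N)) u"
    and dense: "\<alpha> < \<beta>" "\<And>t \<epsilon>. \<alpha> \<le> t \<Longrightarrow> t \<le> \<beta> \<Longrightarrow> \<epsilon> > 0 \<Longrightarrow>
      \<exists>n. \<bar>ln (dist (x (n + N)) u) - ln (dist (x n) u) - t\<bar> \<le> \<epsilon>"
  shows "1 \<le> 3 * s"
proof -
  define c0 where "c0 = c * gap"
  have c0: "c0 > 0" using c(1) gap_pos by (simp add: c0_def)
  have "\<exists>w z z'. w \<in> E \<and> z \<in> E \<and> z' \<in> E \<and> c0 \<le> dist z w \<and> c0 \<le> dist z' w \<and>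
     ln (dist z' w) - ln (dist z w) = ln (dist (x (n + N)) u) - ln (dist (x n) u)" for n
  proof -
    define R where "R = dist (x n) u + dist (x (n + N)) u"
    have R: "R > 0" using c(2)[of n] by (simp add: R_def add_pos_nonneg)
    have "dist a b \<le> R" if "a \<in> {u, x n, x (n + N)}" "b \<in> {u, x n, x (n + N)}" for a b
      using that dist_triangle[of "x n" "x (n + N)" u] dist_triangle[of "x (n + N)" "x n" u]
      unfolding R_def by (auto simp: dist_commute)
    then obtain h r where h: "(h, r) \<in> cylinders" "{u, x n, x (n + N)} \<inter> E \<subseteq> h ` E" "r * gap \<le> R"
      using small_set_in_cylinder[of "{u, x n, x (n + N)}" R] R by blast
    have "u \<in> h ` E" "x n \<in> h ` E" "x (n + N) \<in> h ` E" using h(2) u x by auto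
    then obtain w z z' where wz: "w \<in> E" "z \<in> E" "z' \<in> E" "u = h w" "x n = h z" "x (n + N) = h z'" by blast
    have r: "r > 0" using cylinder_map(1)[OF h(1)] .
    have d: "dist (x n) u = r * dist z w" "dist (x (n + N)) u = r * dist z' w"
      using cylinder_map(2)[OF h(1)] wz by auto
    have big: "c0 \<le> t" if "c * R \<le> r * t" for t
    proof -
      have "r * c0 \<le> c * R" using mult_left_mono[OF h(3), of c] c(1) by (simp add: c0_def mult_ac)
      then have "r * c0 \<le> r * t" using that by simp
      then show ?thesis using r by simp
    qed
    have "c0 \<le> dist z w" "c0 \<le> dist z' w" using big c(3,4)[of n] d by (auto simp: R_def)
    moreover have "ln (dist z' w) - ln (dist z w) = ln (dist (x (n + N)) u) - ln (dist (x n) u)"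
    proof -
      have "dist z w > 0" "dist z' w > 0" using calculation c0 by linarith+
      then show ?thesis unfolding d using r by (simp add: ln_mult)
    qed
    ultimately show ?thesis using wz by blast
  qed
  then obtain w z z' where wz: "\<And>n. w n \<in> E" "\<And>n. z n \<in> E" "\<And>n. z' n \<in> E"
     "\<And>n. c0 \<le> dist (z n) (w n)" "\<And>n. c0 \<le> dist (z' n) (w n)" and
     lnq: "\<And>n. ln (dist (z' n) (w n)) - ln (dist (z n) (w n)) = ln (dist (x (n + N)) u) - ln (dist (x n) u)"
    by metis
  define q where "q n = ln (dist (x (n + N)) u) - ln (dist (x n) u)" for n
  have col3: "colouring_exponent (UNIV :: nat set)
     (\<lambda>\<delta> n n'. (dist (w n) (w n') \<le> \<delta> \<and> dist (z n) (z n') \<le> \<delta>) \<and> dist (z' n) (z' n') \<le> \<delta>) ((s + s) + s)"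
    by (intro colouring_exponent_conj colouring_exponent_pullback[OF col] wz)
  have close: "\<bar>q n - q n'\<bar> \<le> 4 * \<delta> / c0"
    if "dist (w n) (w n') \<le> \<delta>" "dist (z n) (z n') \<le> \<delta>" "dist (z' n) (z' n') \<le> \<delta>" for n n' \<delta>
  proof -
    have "\<bar>ln (dist (z n) (w n)) - ln (dist (z n') (w n'))\<bar> \<le> 2 * \<delta> / c0"
         "\<bar>ln (dist (z' n) (w n)) - ln (dist (z' n') (w n'))\<bar> \<le> 2 * \<delta> / c0"
      by (intro abs_ln_dist_diff_le c0 wz that)+
    then show ?thesis unfolding q_def lnq[symmetric] by (simp add: abs_le_iff)
  qed
  have "1 \<le> ((s + s) + s) * 1"
  proof (rule colouring_exponent_lower_bound[OF col3, where \<kappa> = 1 and \<kappa>' = "c0 * (\<beta> - \<alpha>) / 16"])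
    fix Q0 :: nat
    define Q where "Q = Suc Q0"
    define \<epsilon> where "\<epsilon> = (\<beta> - \<alpha>) / real Q"
    have \<epsilon>: "\<epsilon> > 0" using dense(1) by (simp add: \<epsilon>_def Q_def)
    have "\<exists>n. m < Q \<longrightarrow> \<bar>q n - (\<alpha> + \<epsilon> * real m)\<bar> \<le> \<epsilon> / 4" for m
    proof (cases "m < Q")
      case True
      have "\<epsilon> * real m \<le> \<epsilon> * real Q" using True \<epsilon> by (intro mult_left_mono) auto
      also have "\<dots> = \<beta> - \<alpha>" by (simp add: \<epsilon>_def Q_def)
      finally show ?thesis
        using dense(2)[of "\<alpha> + \<epsilon> * real m" "\<epsilon> / 4"] \<epsilon> unfolding q_def by auto
    qed auto
    then obtain f where f: "\<And>m. m < Q \<Longrightarrow> \<bar>q (f m) - (\<alpha> + \<epsilon> * real m)\<bar> \<le> \<epsilon> / 4" by metis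
    define \<delta> where "\<delta> = c0 * (\<beta> - \<alpha>) / 16 * real Q powr - 1"
    have "real Q powr - 1 = 1 / real Q" by (simp add: powr_minus_divide Q_def)
    moreover have "4 * (c0 * X / 16 * (1 / real Q)) / c0 = X / real Q / 4" for X using c0 by simp
    ultimately have \<delta>: "4 * \<delta> / c0 = \<epsilon> / 4" unfolding \<delta>_def \<epsilon>_def by presburger
    have sep: "\<epsilon> / 2 \<le> \<bar>q (f m) - q (f m')\<bar>" if m: "m < Q" "m' < Q" "m \<noteq> m'" for m m'
    proof -
      have "\<bar>real m - real m'\<bar> \<ge> 1" using m(3) by linarith
      then have "\<epsilon> * 1 \<le> \<epsilon> * \<bar>real m - real m'\<bar>" using \<epsilon> by (intro mult_left_mono) auto
      also have "\<dots> = \<bar>\<epsilon> * real m - \<epsilon> * real m'\<bar>" using \<epsilon> by (simp add: abs_mult right_diff_distrib[symmetric])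
      finally show ?thesis using f[OF m(1)] f[OF m(2)] by linarith
    qed
    have "\<not> ((dist (w (f m)) (w (f m')) \<le> \<delta> \<and> dist (z (f m)) (z (f m')) \<le> \<delta>) \<and> dist (z' (f m)) (z' (f m')) \<le> \<delta>)"
      if m: "m < Q" "m' < Q" "m \<noteq> m'" for m m'
      using close[of "f m" "f m'" \<delta>] sep[OF m] \<epsilon> unfolding \<delta> by auto
    then show "\<exists>Q M f. Q0 \<le> Q \<and> 1 * real Q \<le> real M \<and> (\<forall>m<M. f m \<in> UNIV) \<and>
       (\<forall>m<M. \<forall>m'<M. m \<noteq> m' \<longrightarrow> \<not> ((dist (w (f m)) (w (f m')) \<le> c0 * (\<beta> - \<alpha>) / 16 * real Q powr - 1 \<and>
          dist (z (f m)) (z (f m')) \<le> c0 * (\<beta> - \<alpha>) / 16 * real Q powr - 1) \<and>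
          dist (z' (f m)) (z' (f m')) \<le> c0 * (\<beta> - \<alpha>) / 16 * real Q powr - 1))"
      unfolding \<delta>_def by (intro exI[of _ Q] exI[of _ Q] exI[of _ f]) (auto simp: Q_def)
  qed (use c0 dense(1) in auto)
  then show ?thesis by simp
qed

text \<open>
The cylinder of level \<open>k\<close> about \<open>u\<close> has ratio \<open>exp (- y k)\<close>. The first point of the sequence that comes within
the gap of this cylinder, say with index \<open>n\<close>, and \<open>u\<close> itself have preimages \<open>z\<close> and \<open>w\<close> with
\<open>ln (dist z w) = ln \<kappa> + n ln \<gamma> + y k\<close>. Their distance is bounded below because \<open>n\<close> is minimal.
Hence the colours of \<open>z\<close> and \<open>w\<close> determine \<open>y k\<close> modulo \<open>ln \<gamma>\<close>.
\<close>

lemma geometric_sequence_multi_rotation: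
  fixes x :: "nat \<Rightarrow> 'a"
  assumes col: "colouring_exponent E (\<lambda>\<delta> x y. dist x y \<le> \<delta>) s"
    and u: "u \<in> E" and x: "\<And>n. x n \<in> E"
    and d: "\<And>n. dist (x n) u = \<kappa> * \<gamma> ^ n" "\<kappa> > 0" "0 < \<gamma>" "\<gamma> < 1"
  obtains \<iota> :: "nat \<Rightarrow> nat" where "\<And>k. \<iota> k \<in> {1..l}"
    "colouring_exponent UNIV (\<lambda>\<delta> k k'. \<exists>n::int.
       \<bar>(\<Sum>j<k. - ln (\<rho> (\<iota> j))) - (\<Sum>j<k'. - ln (\<rho> (\<iota> j))) - of_int n * (- ln \<gamma>)\<bar> \<le> \<delta>) (s + s)"
proof -
  obtain \<iota> :: "nat \<Rightarrow> nat" and H where \<iota>: "\<And>k. \<iota> k \<in> {1..l}"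
    and H: "\<And>k. (H k, \<Prod>j<k. \<rho> (\<iota> j)) \<in> cylinders" "\<And>k. u \<in> H k ` E"
    using coding[OF u] by blast
  define r where "r k = (\<Prod>j<k. \<rho> (\<iota> j))" for k
  define y where "y k = (\<Sum>j<k. - ln (\<rho> (\<iota> j)))" for k
  have r: "0 < r k" "r k \<le> 1" for k
    unfolding r_def by (intro prod_pos ballI ratio \<iota>, intro prod_le_1 conjI less_imp_le ratio \<iota>)
  have lnr: "ln (r k) = - y k" for k
    unfolding r_def y_def by (subst ln_prod) (use ratio(1)[OF \<iota>] in \<open>auto simp: sum_negf less_imp_neq[THEN not_sym]\<close>)
  define c0 where "c0 = min \<kappa> (\<gamma> * gap)"
  have c0: "c0 > 0" using d gap_pos by (simp add: c0_def)
  have "\<exists>w z n. w \<in> E \<and> z \<in> E \<and> c0 \<le> dist z w \<and> ln (dist z w) = ln \<kappa> + real n * ln \<gamma> + y k" for k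
  proof -
    have ex: "\<exists>n. \<kappa> * \<gamma> ^ n < gap * r k"
    proof -
      obtain n where "\<gamma> ^ n < gap * r k / \<kappa>"
        using real_arch_pow_inv[of "gap * r k / \<kappa>" \<gamma>] gap_pos r d by auto
      then show ?thesis using d(2) by (auto simp: field_simps)
    qed
    define n where "n = (LEAST n. \<kappa> * \<gamma> ^ n < gap * r k)"
    have n: "\<kappa> * \<gamma> ^ n < gap * r k" unfolding n_def using ex by (rule LeastI_ex)
    have cyl: "(H k, r k) \<in> cylinders" using H(1) by (simp add: r_def)
    have "x n \<in> H k ` E"
      by (rule nearby_point_in_cylinder[OF cyl H(2) x]) (simp add: d(1) n)
    then obtain z where z: "z \<in> E" "x n = H k z" by blast
    obtain w where w: "w \<in> E" "u = H k w" using H(2) by blast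
    have dz: "\<kappa> * \<gamma> ^ n = r k * dist z w" using cylinder_map(2)[OF cyl] d(1)[of n] z w by simp
    \<comment> \<open>Minimality of \<open>n\<close> bounds the previous distance from below;
      for \<open>n = 0\<close> there is none, and \<open>r k \<le> 1\<close> takes its
      place.\<close>
    have "r k * c0 \<le> \<kappa> * \<gamma> ^ n"
    proof (cases n)
      case 0
      have "r k * c0 \<le> 1 * \<kappa>" using r c0 by (intro mult_mono) (auto simp: c0_def)
      then show ?thesis using 0 by simp
    next
      case (Suc n')
      have "\<not> \<kappa> * \<gamma> ^ n' < gap * r k" 
      proof -
        have "n' < n" using Suc by simp
        then show ?thesis unfolding n_def by (rule not_less_Least)
      qed
      then have "\<gamma> * (gap * r k) \<le> \<gamma> * (\<kappa> * \<gamma> ^ n')" using d(3) by (intro mult_left_mono) auto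
      moreover have "r k * c0 \<le> r k * (\<gamma> * gap)" using r[of k] by (intro mult_left_mono) (auto simp: c0_def)
      ultimately show ?thesis using Suc by (simp add: mult_ac)
    qed
    then have c0z: "c0 \<le> dist z w" using r[of k] unfolding dz by simp
    have "ln (r k * dist z w) = ln \<kappa> + real n * ln \<gamma>"
      unfolding dz[symmetric] using d by (simp add: ln_mult ln_realpow)
    moreover have "ln (r k * dist z w) = - y k + ln (dist z w)"
    proof -
      have "dist z w > 0" using c0 c0z by linarith
      then show ?thesis using r[of k] lnr[of k] by (simp add: ln_mult)
    qed
    ultimately have "ln (dist z w) = ln \<kappa> + real n * ln \<gamma> + y k" by simp
    then show ?thesis using w z c0z by blast
  qed
  then obtain w z n where wz: "\<And>k. w k \<in> E" "\<And>k. z k \<in> E" "\<And>k. c0 \<le> dist (z k) (w k)"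
    and lnd: "\<And>k. ln (dist (z k) (w k)) = ln \<kappa> + real (n k) * ln \<gamma> + y k" by metis
  have col2: "colouring_exponent (UNIV :: nat set)
     (\<lambda>\<delta> k k'. dist (w k) (w k') \<le> \<delta> \<and> dist (z k) (z k') \<le> \<delta>) (s + s)"
    by (intro colouring_exponent_conj colouring_exponent_pullback[OF col] wz)
  have "colouring_exponent UNIV (\<lambda>\<delta> k k'. \<exists>n::int. \<bar>y k - y k' - of_int n * (- ln \<gamma>)\<bar> \<le> \<delta>) (s + s)"
  proof (rule colouring_exponent_rescale[OF col2, of "max 1 (2 / c0)"])
    fix \<delta> :: real and k k'
    assume \<delta>: "0 < \<delta>" and cl: "dist (w k) (w k') \<le> \<delta> / max 1 (2 / c0) \<and> dist (z k) (z k') \<le> \<delta> / max 1 (2 / c0)"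
    have "\<bar>ln (dist (z k) (w k)) - ln (dist (z k') (w k'))\<bar> \<le> 2 * (\<delta> / max 1 (2 / c0)) / c0"
      using cl by (intro abs_ln_dist_diff_le c0 wz) auto
    also have "\<dots> = (2 / c0) * \<delta> / max 1 (2 / c0)" by simp
    also have "\<dots> \<le> max 1 (2 / c0) * \<delta> / max 1 (2 / c0)"
      using \<delta> by (intro divide_right_mono mult_right_mono) auto
    also have "\<dots> = \<delta>" by (rule nonzero_mult_div_cancel_left) linarith
    finally have "\<bar>y k - y k' - of_int (int (n k) - int (n k')) * (- ln \<gamma>)\<bar> \<le> \<delta>"
      unfolding lnd by (simp add: algebra_simps)
    then show "\<exists>n::int. \<bar>y k - y k' - of_int n * (- ln \<gamma>)\<bar> \<le> \<delta>" by blast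
  qed auto
  then show thesis using that[of \<iota>] \<iota> unfolding y_def by blast
qed

end

section \<open>Affine embeddings of self-similar sets\<close>

lemma dist_similitude:
  assumes "similitude \<rho> \<phi>"
  shows "dist (\<phi> x) (\<phi> y) = \<rho> * dist x y"
proof -
  obtain P a where P: "\<rho> > 0" "orthogonal_matrix P" "\<And>x. \<phi> x = \<rho> *\<^sub>R (P *v x) + a"
    using assms unfolding similitude_def by blast
  have "orthogonal_transformation ((*v) P)"
    using P(2) by (simp add: orthogonal_transformation_matrix)
  then have "norm (P *v (x - y)) = norm (x - y)" by (rule orthogonal_transformation_norm)
  then show ?thesis
    using P(1) by (simp add: P(3) dist_norm matrix_vector_mult_diff_distrib scaleR_diff_right[symmetric])
qed

lemma strong_separation_gap:
  assumes ifs: "similitude_ifs l \<phi> \<rho>" and att: "attractor l \<phi> E" and sep: "strong_separation l \<phi> E"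
  obtains gap where "separated_ifs l \<phi> \<rho> E gap"
proof -
  have sim: "similitude (\<rho> i) (\<phi> i)" "\<rho> i < 1" "0 < \<rho> i" if "i \<in> {1..l}" for i
    using ifs that by (auto simp: similitude_ifs_def similitude_def)
  have E: "E \<noteq> {}" "compact E" "E = (\<Union>i\<in>{1..l}. \<phi> i ` E)"
    using att unfolding attractor_def by blast+
  have comp: "compact (\<phi> i ` E)" if "i \<in> {1..l}" for i
  proof (rule compact_continuous_image[OF _ E(2)])
    have "continuous_on UNIV (\<phi> i)"
    proof (rule continuous_on_subset[OF lipschitz_on_continuous_on[of "\<rho> i"]])
      show "(\<rho> i)-lipschitz_on UNIV (\<phi> i)"
        using sim[OF that] by (intro lipschitz_onI) (auto simp: dist_similitude)
    qed simp
    then show "continuous_on E (\<phi> i)" by (rule continuous_on_subset) simp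
  qed
  have "\<exists>\<delta>>0. \<forall>x\<in>\<phi> i ` E. \<forall>y\<in>\<phi> j ` E. \<delta> \<le> dist x y"
    if "i \<in> {1..l}" "j \<in> {1..l}" "i \<noteq> j" for i j
    using that comp sep by (intro separate_compact_closed compact_imp_closed)
      (auto simp: strong_separation_def disjoint_family_on_def)
  then obtain \<delta> where \<delta>: "\<And>i j. i \<in> {1..l} \<Longrightarrow> j \<in> {1..l} \<Longrightarrow> i \<noteq> j \<Longrightarrow>
      \<delta> i j > 0 \<and> (\<forall>x\<in>\<phi> i ` E. \<forall>y\<in>\<phi> j ` E. \<delta> i j \<le> dist x y)"
    by metis
  define D where "D = insert 1 {\<delta> i j | i j. i \<in> {1..l} \<and> j \<in> {1..l} \<and> i \<noteq> j}"
  have "{\<delta> i j | i j. i \<in> {1..l} \<and> j \<in> {1..l} \<and> i \<noteq> j} \<subseteq> (\<lambda>(i, j). \<delta> i j) ` ({1..l} \<times> {1..l})"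
    by auto
  then have fin: "finite D" unfolding D_def using finite_subset by fastforce
  have "separated_ifs l \<phi> \<rho> E (Min D)"
  proof
    show "0 < Min D" using fin \<delta> by (subst Min_gr_iff) (auto simp: D_def)
    fix i j x y assume ij: "i \<in> {1..l}" "j \<in> {1..l}" "i \<noteq> j" "x \<in> E" "y \<in> E"
    have "Min D \<le> \<delta> i j" using fin ij by (intro Min_le) (auto simp: D_def)
    also have "\<dots> \<le> dist (\<phi> i x) (\<phi> j y)" using \<delta>[OF ij(1-3)] ij by blast
    finally show "Min D \<le> dist (\<phi> i x) (\<phi> j y)" .
  qed (use sim E in \<open>auto simp: dist_similitude\<close>)
  then show thesis by (rule that)
qed

lemma norm_matrix_mult_orthogonal:
  fixes X P :: "real^'n^'n"
  assumes "orthogonal_matrix P"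
  shows "norm (X ** P) = norm X"
proof -
  have orth: "orthogonal_transformation ((*v) (transpose P))"
    using assms by (simp add: orthogonal_transformation_matrix)
  have "(X ** P) $ i = transpose P *v (X $ i)" for i
    by (simp add: vec_eq_iff matrix_matrix_mult_def matrix_vector_mult_def transpose_def mult.commute)
  then have "norm ((X ** P) $ i) = norm (X $ i)" for i
    using orthogonal_transformation_norm[OF orth] by simp
  then show ?thesis by (simp add: norm_vec_def)
qed

lemma norm_transpose:
  fixes X :: "real^'n^'n"
  shows "norm (transpose X) = norm X"
proof -
  have "(\<Sum>i\<in>UNIV. \<Sum>j\<in>UNIV. (X $ j $ i)\<^sup>2) = (\<Sum>i\<in>UNIV. \<Sum>j\<in>UNIV. (X $ i $ j)\<^sup>2)"
    by (rule sum.swap)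
  then show ?thesis
    by (simp add: norm_vec_def L2_set_def transpose_def sum_nonneg)
qed

text \<open>
Through this isometry of matrices \<open>|M P\<^sup>n v|\<^sup>2\<close> becomes linear in the \<open>n\<close>-th point of an orbit: it is the value at \<open>v\<close>
of the quadratic form of the \<open>n\<close>-th conjugate of \<open>M\<^sup>T M\<close>.
\<close>

lemma orthogonal_transformation_conjugation:
  fixes P :: "real^'n^'n"
  assumes "orthogonal_matrix P"
  shows "orthogonal_transformation (\<lambda>X. transpose P ** X ** P)"
  unfolding orthogonal_transformation
proof (intro conjI allI)
  have "(A + B) ** P = A ** P + B ** P" for A B :: "real^'n^'n"
    by (vector matrix_matrix_mult_def sum.distrib[symmetric] field_simps)
  moreover have "(c *\<^sub>R A) ** B = c *\<^sub>R (A ** B)" for c and A B :: "real^'n^'n"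
    by (vector matrix_matrix_mult_def sum_distrib_left mult.assoc)
  ultimately show "linear (\<lambda>X. transpose P ** X ** P)"
    by (intro linearI) (simp_all add: matrix_add_ldistrib matrix_scalar_ac)
  fix X
  have "norm (transpose P ** X ** P) = norm (transpose (transpose P ** X))"
    by (simp add: norm_matrix_mult_orthogonal[OF assms] norm_transpose)
  also have "\<dots> = norm X"
    by (simp add: matrix_transpose_mul transpose_transpose norm_matrix_mult_orthogonal[OF assms] norm_transpose)
  finally show "norm (transpose P ** X ** P) = norm X" .
qed

lemma conjugation_funpow_form:
  fixes P X :: "real^'n^'n"
  shows "v \<bullet> (((\<lambda>X. transpose P ** X ** P) ^^ n) X *v v) = (((*v) P ^^ n) v) \<bullet> (X *v (((*v) P ^^ n) v))"
proof (induction n arbitrary: v)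
  case (Suc n)
  have "v \<bullet> ((transpose P ** Y ** P) *v v) = (P *v v) \<bullet> (Y *v (P *v v))" for Y
  proof -
    have "v \<bullet> ((transpose P ** Y ** P) *v v) = ((Y *v (P *v v)) v* P) \<bullet> v"
      by (simp add: matrix_vector_mul_assoc[symmetric] inner_commute)
    also have "\<dots> = (Y *v (P *v v)) \<bullet> (P *v v)" by (rule dot_lmul_matrix)
    finally show ?thesis by (simp add: inner_commute)
  qed
  then show ?case using Suc[of "P *v v"] by (simp add: funpow_swap1)
qed simp

text \<open>
The excluded case is the last branch at \<open>lam = 0\<close>, where the bound would be \<open>1/2\<close>.
\<close>

lemma dim_bound_le_quarter:
  assumes "l = 2 \<or> lam \<ge> 1"
  shows "dim_bound l lam \<le> 1 / 4"
  using assms by (auto simp: dim_bound_def divide_simps)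

text \<open>
The power \<open>q\<close> of \<open>P\<close> comes from \<open>orbit_functional_averages\<close>. If \<open>|M P\<^sup>q\<^sup>n v|\<close> depends on \<open>n\<close>, the attractor
has too large a dimension by \<open>oscillation_exponent\<close>. Otherwise \<open>multi_rotation_exponent\<close> puts \<open>q ln \<gamma>\<close> into the cone
of the \<open>ln \<rho>\<^sub>i\<close>, and dividing by \<open>q\<close> keeps the coefficients rational and non-negative.
\<close>

lemma contraction_ratio_in_cone:
  fixes E F :: "(real^'n) set" and M :: "real^'n^'n"
  assumes ifs: "separated_ifs l \<phi> \<rho> E gap"
    and dim: "hausdorff_dim E < ennreal (dim_bound l (log_ratio_rank l \<rho>))"
    and \<psi>: "similitude \<gamma> \<psi>" "\<gamma> < 1" and F: "compact F" "\<psi> ` F \<subseteq> F" "\<not> is_singleton F" "F \<noteq> {}"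
    and M: "invertible M" "(\<lambda>x. M *v x + a) ` F \<subseteq> E"
  obtains t :: "nat \<Rightarrow> rat" where "\<And>i. i \<in> {1..l} \<Longrightarrow> t i \<ge> 0"
    "ln \<gamma> = (\<Sum>i\<in>{1..l}. of_rat (t i) * ln (\<rho> i))"
proof -
  interpret separated_ifs l \<phi> \<rho> E gap by (rule ifs)
  let ?lam = "log_ratio_rank l \<rho>"
  obtain s where s: "s \<ge> 0" "hausdorff_measure s E = 0" "s < dim_bound l ?lam"
  proof -
    obtain s where "s \<ge> 0" "hausdorff_measure s E = 0" "ennreal s < ennreal (dim_bound l ?lam)"
      using dim unfolding hausdorff_dim_def INF_less_iff by blast
    then show thesis using that by (simp add: ennreal_less_iff)
  qed
  have col: "colouring_exponent E (\<lambda>\<delta> x y. dist x y \<le> \<delta>) s"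
    by (rule null_set_colouring_exponent[OF s(1,2)])
  obtain B where B: "B \<subseteq> (\<lambda>i. ln (\<rho> i)) ` {1..l}" "rat_vs.independent B"
    "(\<lambda>i. ln (\<rho> i)) ` {1..l} \<subseteq> rat_vs.span B" "card B = rat_vs.dim ((\<lambda>i. ln (\<rho> i)) ` {1..l})"
    by (rule rat_vs.basis_exists)
  have finB: "finite B" using B(1) finite_subset by blast
  have cardB: "card B = ?lam" using B(4) by (simp add: log_ratio_rank_def)
  have span: "(\<lambda>i. - ln (\<rho> i)) ` {1..l} \<subseteq> rat_vs.span B"
  proof
    fix v assume "v \<in> (\<lambda>i. - ln (\<rho> i)) ` {1..l}"
    then obtain i where i: "i \<in> {1..l}" "v = - ln (\<rho> i)" by blast
    have "ln (\<rho> i) \<in> rat_vs.span B" using B(3) i(1) by blast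
    then show "v \<in> rat_vs.span B" unfolding i(2) by (rule rat_vs.span_neg)
  qed
  have quarter: "s < 1 / 4"
  proof -
    obtain i where i: "i \<in> {1..l}" using nonempty invariant by blast
    have "B \<noteq> {}"
    proof
      assume "B = {}"
      moreover have "ln (\<rho> i) \<in> rat_vs.span B" using B(3) i by blast
      ultimately have "ln (\<rho> i) = 0" by simp
      then show False using ratio[OF i] by simp
    qed
    then have "card B > 0" using finB by (simp add: card_gt_0_iff)
    then have "?lam \<ge> 1" using cardB by simp
    then have "dim_bound l ?lam \<le> 1 / 4" by (intro dim_bound_le_quarter) simp
    then show ?thesis using s(3) by linarith
  qed
  obtain P b where P: "\<gamma> > 0" "orthogonal_matrix P" "\<And>x. \<psi> x = \<gamma> *\<^sub>R (P *v x) + b"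
    using \<psi>(1) unfolding similitude_def by blast
  have orthP: "orthogonal_transformation ((*v) P)"
    using P(2) by (simp add: orthogonal_transformation_matrix)
  have Pn: "norm (((*v) P ^^ n) v) = norm v" for n v
    using orthogonal_transformation_norm[OF orthogonal_transformation_funpow[OF orthP]] .
  obtain x0 where x0: "x0 \<in> F" "\<psi> x0 = x0"
    using Banach_fix[of F \<gamma> \<psi>] F \<psi> P(1) by (auto simp: dist_similitude compact_imp_complete less_imp_le)
  obtain y0 where y0: "y0 \<in> F" "y0 \<noteq> x0" using F(3) x0(1) by (metis is_singletonI' empty_iff)
  define v where "v = y0 - x0"
  have v: "v \<noteq> 0" using y0 by (simp add: v_def)
  have iter: "(\<psi> ^^ n) y0 \<in> F \<and> (\<psi> ^^ n) y0 - x0 = \<gamma> ^ n *\<^sub>R (((*v) P ^^ n) v)" for n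
  proof (induction n)
    case (Suc n)
    have "\<psi> z - x0 = \<gamma> *\<^sub>R (P *v (z - x0))" for z
    proof -
      have "\<psi> z - x0 = \<psi> z - \<psi> x0" using x0(2) by simp
      then show ?thesis by (simp add: P(3) matrix_vector_mult_diff_distrib scaleR_diff_right)
    qed
    then show ?case using Suc F(2) by (auto simp: matrix_vector_mult_scaleR)
  qed (simp add: y0 v_def)
  define u where "u = M *v x0 + a"
  define x where "x n = M *v ((\<psi> ^^ n) y0) + a" for n
  have uE: "u \<in> E" and xE: "x n \<in> E" for n
    using M(2) x0(1) iter by (auto simp: u_def x_def)
  define N where "N = transpose M ** M"
  define w where "w n = v \<bullet> (((\<lambda>X. transpose P ** X ** P) ^^ n) N *v v)" for n
  have w: "w n = (norm (M *v (((*v) P ^^ n) v)))\<^sup>2" for n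
  proof -
    have "w n = (((*v) P ^^ n) v) \<bullet> (N *v (((*v) P ^^ n) v))"
      unfolding w_def by (rule conjugation_funpow_form)
    also have "z \<bullet> (N *v z) = (M *v z) \<bullet> (M *v z)" for z
    proof -
      have "z \<bullet> (N *v z) = ((M *v z) v* M) \<bullet> z"
        by (simp add: N_def matrix_vector_mul_assoc[symmetric] inner_commute)
      also have "\<dots> = (M *v z) \<bullet> (M *v z)" by (rule dot_lmul_matrix)
      finally show ?thesis .
    qed
    finally show ?thesis by (simp add: power2_norm_eq_inner)
  qed
  have dist_x: "dist (x n) u = \<gamma> ^ n * sqrt (w n)" for n
  proof -
    have "x n - u = M *v ((\<psi> ^^ n) y0 - x0)" by (simp add: x_def u_def matrix_vector_mult_diff_distrib)
    also have "\<dots> = \<gamma> ^ n *\<^sub>R (M *v (((*v) P ^^ n) v))" using iter by (simp add: matrix_vector_mult_scaleR)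
    finally show ?thesis using P(1) by (simp add: dist_norm w)
  qed
  have lin: "linear (\<lambda>X :: real^'n^'n. v \<bullet> (X *v v))"
    by (rule linearI) (simp_all add: matrix_vector_mult_add_rdistrib inner_add_right scaleR_matrix_vector_assoc[symmetric])
  obtain q C where q: "q \<ge> 1"
    "\<And>\<epsilon>. \<epsilon> > 0 \<Longrightarrow> \<exists>p\<ge>1. \<forall>n. \<bar>w (q * (n + p)) - w (q * n)\<bar> \<le> \<epsilon>"
    "\<And>p i. p \<ge> 1 \<Longrightarrow> \<exists>B. \<forall>K. \<bar>\<Sum>k<K. w (q * (i + p * k)) - C\<bar> \<le> B"
    using orbit_functional_averages[OF orthogonal_transformation_conjugation[OF P(2)] lin, where x = N, folded w_def]
    by blast
  define W where "W n = w (q * n)" for n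
  define \<gamma>' where "\<gamma>' = \<gamma> ^ q"
  have \<gamma>': "0 < \<gamma>'" "\<gamma>' < 1" using P(1) \<psi>(2) q(1) by (auto simp: \<gamma>'_def power_less_one_iff)
  have dist_q: "dist (x (q * n)) u = \<gamma>' ^ n * sqrt (W n)" for n
    by (simp add: dist_x W_def \<gamma>'_def power_mult)
  have "inj ((*v) M)" using M(1) by (simp add: invertible_eq_bij bij_is_inj)
  then obtain c1 where c1: "c1 > 0" "\<And>z. c1 * norm z \<le> norm (M *v z)"
    using linear_inj_bounded_below_pos[of "(*v) M"] by (auto simp: mult.commute)
  obtain c2 where c2: "c2 > 0" "\<And>z. norm (M *v z) \<le> c2 * norm z"
    using linear_bounded_pos[of "(*v) M"] by (auto simp: mult.commute)
  define lo where "lo = c1 * norm v"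
  define hi where "hi = c2 * norm v"
  have lo: "lo > 0" using c1 v by (simp add: lo_def)
  have sqrtW: "sqrt (W n) = norm (M *v (((*v) P ^^ (q * n)) v))" for n by (simp add: W_def w)
  have lohi: "lo \<le> sqrt (W n)" "sqrt (W n) \<le> hi" for n
    unfolding sqrtW lo_def hi_def using c1(2) c2(2) Pn by metis+
  have Wlo: "lo\<^sup>2 \<le> W n" for n
  proof -
    have "W n \<ge> 0" by (simp add: W_def w)
    then show ?thesis using lohi(1)[of n] lo by (metis power_mono less_imp_le real_sqrt_pow2)
  qed
  have Wpos: "W n > 0" for n using Wlo[of n] lo by (meson less_le_trans zero_less_power)
  have Wconst: "W n = W 0" for n
  proof (rule ccontr)
    assume nc: "W n \<noteq> W 0"
    obtain \<alpha> \<beta> where ab: "\<alpha> < \<beta>" "\<And>t \<epsilon>. \<alpha> \<le> t \<Longrightarrow> t \<le> \<beta> \<Longrightarrow> \<epsilon> > 0 \<Longrightarrow>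
        \<exists>k. \<bar>ln (W (k + n)) - ln (W k) - t\<bar> \<le> \<epsilon>"
      by (rule log_ratio_dense_in_interval[of "lo\<^sup>2" W C n])
        (use lo Wlo q(2,3) nc in \<open>auto simp: W_def\<close>)
    define d where "d k = dist (x (q * k)) u" for k
    have dq: "d k = \<gamma>' ^ k * sqrt (W k)" for k by (simp add: d_def dist_q)
    have dpos: "d k > 0" for k using \<gamma>' Wpos by (simp add: d_def dist_q)
    have hilo: "hi \<ge> lo" "hi > 0" using lohi[of 0] lo by linarith+
    define \<kappa> where "\<kappa> = \<gamma>' ^ n * (lo / hi)"
    define K where "K = hi / lo"
    have \<kappa>: "0 < \<kappa>" "\<kappa> \<le> 1"
    proof -
      show "0 < \<kappa>" using \<gamma>' lo hilo by (simp add: \<kappa>_def)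
      have "\<gamma>' ^ n * (lo / hi) \<le> 1 * 1"
        using \<gamma>' lo hilo by (intro mult_mono) (auto simp: power_le_one less_imp_le)
      then show "\<kappa> \<le> 1" by (simp add: \<kappa>_def)
    qed
    have K: "K > 0" using lo hilo by (simp add: K_def)
    have upper: "d (k + n) \<le> K * d k" for k
    proof -
      have "sqrt (W (k + n)) \<le> K * sqrt (W k)"
      proof -
        have "hi = K * lo" using lo by (simp add: K_def)
        also have "\<dots> \<le> K * sqrt (W k)" using K lohi(1) by (intro mult_left_mono) auto
        finally show ?thesis using lohi(2)[of "k + n"] by linarith
      qed
      then have "\<gamma>' ^ n * sqrt (W (k + n)) \<le> 1 * (K * sqrt (W k))"
        using \<gamma>' Wpos by (intro mult_mono) (auto simp: power_le_one less_imp_le)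
      then have "\<gamma>' ^ k * (\<gamma>' ^ n * sqrt (W (k + n))) \<le> \<gamma>' ^ k * (K * sqrt (W k))"
        using \<gamma>' by (intro mult_left_mono) auto
      then show ?thesis by (simp add: dq power_add mult_ac)
    qed
    have lower: "\<kappa> * d k \<le> d (k + n)" for k
    proof -
      have "lo / hi * sqrt (W k) \<le> lo / hi * hi" using lo hilo lohi(2) by (intro mult_left_mono) auto
      then have "lo / hi * sqrt (W k) \<le> sqrt (W (k + n))" using hilo lohi(1)[of "k + n"] by simp
      then have "\<gamma>' ^ (k + n) * (lo / hi * sqrt (W k)) \<le> \<gamma>' ^ (k + n) * sqrt (W (k + n))"
        using \<gamma>' by (intro mult_left_mono) auto
      then show ?thesis by (simp add: dq \<kappa>_def power_add mult_ac)
    qed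
    \<comment> \<open>The distances with indices \<open>k\<close> and \<open>k + n\<close> are
      comparable, so each of them is at least \<open>c\<close> times their sum.\<close>
    define c where "c = \<kappa> / (1 + K)"
    have c: "c > 0" using \<kappa> K by (simp add: c_def)
    have cle: "c * (d k + d (k + n)) \<le> \<kappa> * d k" for k
    proof -
      have "c * (d k + d (k + n)) \<le> c * ((1 + K) * d k)"
        using upper[of k] c by (intro mult_left_mono) (auto simp: algebra_simps)
      also have "\<dots> = \<kappa> * d k" using K by (simp add: c_def)
      finally show ?thesis .
    qed
    have "1 \<le> 3 * s"
    proof (rule oscillation_exponent[OF col uE, of "\<lambda>k. x (q * k)" c n
        "real n * ln \<gamma>' + \<alpha> / 2" "real n * ln \<gamma>' + \<beta> / 2"])
      show "c * (dist (x (q * k)) u + dist (x (q * (k + n))) u) \<le> dist (x (q * k)) u" for k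
        using cle[of k] \<kappa>(2) dpos[of k] mult_right_mono[of \<kappa> 1 "d k"] unfolding d_def by linarith
      show "c * (dist (x (q * k)) u + dist (x (q * (k + n))) u) \<le> dist (x (q * (k + n))) u" for k
        using cle[of k] lower[of k] unfolding d_def by linarith
      fix t \<epsilon> :: real
      assume t: "real n * ln \<gamma>' + \<alpha> / 2 \<le> t" "t \<le> real n * ln \<gamma>' + \<beta> / 2" and \<epsilon>: "\<epsilon> > 0"
      then obtain k where k: "\<bar>ln (W (k + n)) - ln (W k) - 2 * (t - real n * ln \<gamma>')\<bar> \<le> \<epsilon>"
        using ab(2)[of "2 * (t - real n * ln \<gamma>')" \<epsilon>] by auto
      have lnd: "ln (dist (x (q * i)) u) = real i * ln \<gamma>' + ln (W i) / 2" for i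
        using \<gamma>' Wpos[of i] by (simp add: dist_q ln_mult ln_realpow ln_sqrt)
      have "\<bar>ln (dist (x (q * (k + n))) u) - ln (dist (x (q * k)) u) - t\<bar> \<le> \<epsilon>"
        unfolding lnd using k \<epsilon> by (simp add: abs_le_iff algebra_simps)
      then show "\<exists>k. \<bar>ln (dist (x (q * (k + n))) u) - ln (dist (x (q * k)) u) - t\<bar> \<le> \<epsilon>" by blast
    qed (use c xE dpos ab(1) in \<open>auto simp: d_def\<close>)
    then show False using quarter by linarith
  qed
  have geo: "dist (x (q * n)) u = sqrt (W 0) * \<gamma>' ^ n" for n
    by (simp add: dist_q Wconst[of n])
  have W0: "sqrt (W 0) > 0" using Wpos[of 0] by simp
  obtain \<iota> :: "nat \<Rightarrow> nat" where \<iota>: "\<And>k. \<iota> k \<in> {1..l}"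
    and rot: "colouring_exponent UNIV (\<lambda>\<delta> k k'. \<exists>n::int.
       \<bar>(\<Sum>j<k. - ln (\<rho> (\<iota> j))) - (\<Sum>j<k'. - ln (\<rho> (\<iota> j))) - of_int n * (- ln \<gamma>')\<bar> \<le> \<delta>) (s + s)"
    using geometric_sequence_multi_rotation[OF col uE, of "\<lambda>n. x (q * n)", OF xE geo W0 \<gamma>'] by blast
  have pos: "0 < - ln (\<rho> i)" if "i \<in> {1..l}" for i using ratio[OF that] by simp
  have g: "0 < - ln \<gamma>'" using \<gamma>' by simp
  have "\<exists>t :: nat \<Rightarrow> rat. (\<forall>i\<in>{1..l}. 0 \<le> t i) \<and> - ln \<gamma>' = (\<Sum>i\<in>{1..l}. of_rat (t i) * - ln (\<rho> i))"
  proof (rule ccontr)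
    assume nocone: "\<not> ?thesis"
    note bounds = multi_rotation_exponent[OF pos \<iota> g nocone refl finB span rot]
    show False
    proof (cases "l = 2")
      case True
      have "1 \<le> 2 * (s + s)" by (rule bounds(2)[OF _ True])
      then show False using quarter by (simp add: field_simps)
    next
      case False
      have "1 \<le> (s + s) * (real ?lam + 1)" unfolding cardB[symmetric] by (rule bounds(1))
      moreover have "s < 1 / (2 * real ?lam + 2)"
        using s(3) False by (auto simp: dim_bound_def split: if_splits)
      then have "s * (2 * real ?lam + 2) < 1" by (simp add: pos_less_divide_eq)
      ultimately show False by (simp add: algebra_simps)
    qed
  qed
  then obtain t :: "nat \<Rightarrow> rat" where t: "\<And>i. i \<in> {1..l} \<Longrightarrow> 0 \<le> t i"
    "- ln \<gamma>' = (\<Sum>i\<in>{1..l}. of_rat (t i) * - ln (\<rho> i))" by blast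
  show thesis
  proof (rule that[of "\<lambda>i. t i / of_nat q"])
    show "0 \<le> t i / of_nat q" if "i \<in> {1..l}" for i using t(1)[OF that] by simp
    have "real q * ln \<gamma> = ln \<gamma>'" using P(1) by (simp add: \<gamma>'_def ln_realpow)
    also have "\<dots> = (\<Sum>i\<in>{1..l}. of_rat (t i) * ln (\<rho> i))" using t(2) by (simp add: sum_negf)
    finally have "ln \<gamma> = (\<Sum>i\<in>{1..l}. of_rat (t i) * ln (\<rho> i)) / real q"
      using q(1) by (simp add: field_simps)
    then show "ln \<gamma> = (\<Sum>i\<in>{1..l}. of_rat (t i / of_nat q) * ln (\<rho> i))"
      by (simp add: sum_divide_distrib of_rat_divide)
  qed
qed

theorem theorem1p2:
  fixes E F :: "(real^'n) set"
    and \<phi> \<psi> :: "nat \<Rightarrow> real^'n \<Rightarrow> real^'n"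
    and \<rho> \<gamma> :: "nat \<Rightarrow> real"
    and l m :: nat
  assumes "similitude_ifs l \<phi> \<rho>" and "attractor l \<phi> E"
    and "similitude_ifs m \<psi> \<gamma>" and "attractor m \<psi> F"
    and "totally_disconnected E" and "nontrivial E"
    and "totally_disconnected F" and "nontrivial F"
    and "affinely_embeddable F E"
    and "strong_separation l \<phi> E"
    and "hausdorff_dim E < ennreal (dim_bound l (log_ratio_rank l \<rho>))"
  shows "(\<forall>j\<in>{1..m}. \<exists>t :: nat \<Rightarrow> rat.
            (\<forall>i\<in>{1..l}. t i \<ge> 0) \<and> \<gamma> j = (\<Prod>i\<in>{1..l}. \<rho> i powr of_rat (t i)))
       \<and> (\<forall>r. (\<forall>i\<in>{1..l}. \<rho> i = r) \<longrightarrow> (\<forall>j\<in>{1..m}. ln (\<gamma> j) / ln r \<in> \<rat>))"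
proof -
  obtain gap where ifs: "separated_ifs l \<phi> \<rho> E gap"
    using strong_separation_gap[OF assms(1,2,10)] .
  obtain M a where M: "invertible M" "(\<lambda>x. M *v x + a) ` F \<subseteq> E"
    using assms(9) unfolding affinely_embeddable_def by blast
  have \<rho>: "0 < \<rho> i" "\<rho> i < 1" if "i \<in> {1..l}" for i
    using separated_ifs.ratio[OF ifs that] by auto
  have F: "compact F" "F \<noteq> {}" "F = (\<Union>j\<in>{1..m}. \<psi> j ` F)"
    using assms(4) unfolding attractor_def by blast+
  have cone: "\<exists>t :: nat \<Rightarrow> rat. (\<forall>i\<in>{1..l}. t i \<ge> 0) \<and> ln (\<gamma> j) = (\<Sum>i\<in>{1..l}. of_rat (t i) * ln (\<rho> i))"
    if j: "j \<in> {1..m}" for j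
  proof -
    have "similitude (\<gamma> j) (\<psi> j)" "\<gamma> j < 1" using assms(3) j by (auto simp: similitude_ifs_def)
    moreover have "\<psi> j ` F \<subseteq> F" using F(3) j by blast
    ultimately show ?thesis
      using contraction_ratio_in_cone[OF ifs assms(11) _ _ F(1) _ _ F(2) M] assms(8)
      unfolding nontrivial_def by metis
  qed
  have \<gamma>: "\<gamma> j > 0" if "j \<in> {1..m}" for j
    using assms(3) that by (auto simp: similitude_ifs_def similitude_def)
  show ?thesis
  proof (intro conjI ballI allI impI)
    fix j assume j: "j \<in> {1..m}"
    obtain t :: "nat \<Rightarrow> rat" where t: "\<forall>i\<in>{1..l}. t i \<ge> 0" "ln (\<gamma> j) = (\<Sum>i\<in>{1..l}. of_rat (t i) * ln (\<rho> i))"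
      using cone[OF j] by blast
    have "\<gamma> j = exp (\<Sum>i\<in>{1..l}. of_rat (t i) * ln (\<rho> i))" using t(2) \<gamma>[OF j] by (metis exp_ln)
    also have "\<dots> = (\<Prod>i\<in>{1..l}. \<rho> i powr of_rat (t i))"
      unfolding exp_sum[OF finite_atLeastAtMost] using \<rho> by (intro prod.cong refl) (force simp: powr_def)
    finally show "\<exists>t :: nat \<Rightarrow> rat. (\<forall>i\<in>{1..l}. t i \<ge> 0) \<and> \<gamma> j = (\<Prod>i\<in>{1..l}. \<rho> i powr of_rat (t i))"
      using t(1) by blast
  next
    fix r j assume r: "\<forall>i\<in>{1..l}. \<rho> i = r" and j: "j \<in> {1..m}"
    obtain t :: "nat \<Rightarrow> rat" where "ln (\<gamma> j) = (\<Sum>i\<in>{1..l}. of_rat (t i) * ln (\<rho> i))"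
      using cone[OF j] by blast
    also have "\<dots> = of_rat (\<Sum>i\<in>{1..l}. t i) * ln r" using r by (simp add: of_rat_sum sum_distrib_right)
    finally show "ln (\<gamma> j) / ln r \<in> \<rat>" by (cases "ln r = 0") simp_all
  qed
qed

end
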